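(* Let $0<s<1$, let $\Omega:S^1\to\mathbb{R}$ be smooth, strictly positive, with $\Omega(\theta+\pi)=\Omega(\theta)$, and let $W(\mathbf{x})=|\mathbf{x}|^{-s}\Omega(\theta)+|\mathbf{x}|^2$ on $\mathbb{R}^2$ with associated energy $E$. Let $$\rho(\mathbf{x})=\psi(x_2)\delta(x_1),$$ where $\psi$ is a nonnegative continuous function on $\mathbb{R}$ with compact support and $\int_{\mathbb{R}}\psi(x)\,\mathrm{d}x=1$, and assume $\psi$ is $C^1$ in a neighborhood of $0$. Then, as $\epsilon\to0^+$, $$(W*\rho)(\epsilon,0)-(W*\rho)(0,0)=\frac{1}{2\tau_{2-s}}\tilde\Omega(0)\psi(0)\epsilon^{1-s}+O(\epsilon),$$ where $\tau_{2-s}$ is a negative number (given in the context). When $\Omega$ achieves a local minimum at $\pi/2$, the error term can be improved to $O(\epsilon^{2-s})$. In particular, if $\tilde\Omega(0)>0$ and $\psi(0)>0$, then $\rho$ is not a $d_\infty$-local minimizer of $E$.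
   Context: $S^1=[-\pi,\pi)$ is the set of angles (mod $2\pi$); $\theta$ is the angle of $\mathbf{x}\in\mathbb{R}^2\setminus\{0\}$, i.e. $\mathbf{x}/|\mathbf{x}|=(\cos\theta,\sin\theta)$. The energy is $E[\rho]=\frac12\int_{\mathbb{R}^2}\int_{\mathbb{R}^2}W(\mathbf{x}-\mathbf{y})\rho(\mathbf{y})\,\mathrm{d}\mathbf{y}\,\rho(\mathbf{x})\,\mathrm{d}\mathbf{x}$ for probability measures $\rho$ on $\mathbb{R}^2$. $d_\infty$ is the Wasserstein-infinity distance; $\rho$ is a $d_\infty$-local minimizer of $E$ if there is $\epsilon_0>0$ such that $E[\rho]\le E[\rho']$ for every probability measure $\rho'$ with $d_\infty(\rho,\rho')<\epsilon_0$. The Fourier transform is $\mathcal{F}[f](\xi)=\int_{\mathbb{R}^2}f(\mathbf{x})e^{-2\pi i\mathbf{x}\cdot\xi}\,\mathrm{d}\mathbf{x}$ (extended to tempered distributions). Writing $\xi=|\xi|(\cos\varphi,\sin\varphi)$, $\tilde\Omega$ is defined by $\mathcal{F}[|\mathbf{x}|^{-s}\Omega(\theta)](\xi)=|\xi|^{-2+s}\tilde\Omega(\varphi)$; explicitly, $$\tilde\Omega(\varphi)=\tau_{2-s}\int_{-\pi}^{\pi}|\cos(\varphi-\theta)|^{-2+s}\Big(\Omega(\theta)-\Omega(\varphi+\tfrac{\pi}{2})\Big)\mathrm{d}\theta+c_s\,\Omega(\varphi+\tfrac{\pi}{2}),$$ with $\tau_r=(2\pi)^{-r}\Gamma(r)\cos\frac{r\pi}{2}$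 for $0<r<2$ and $c_s=\pi^{s-1}\frac{\Gamma((2-s)/2)}{\Gamma(s/2)}$. *)

theory Defs
  imports "HOL-Probability.Probability" "HOL-Library.Landau_Symbols"
begin

definition smooth :: "(real \<Rightarrow> real) \<Rightarrow> bool" where
  "smooth f \<longleftrightarrow> (\<forall>k x. (deriv ^^ k) f differentiable at x)"

text \<open>
  The plane is \<^typ>\<open>real \<times> real\<close>, whose norm is the Euclidean one. A function on the circle of angles
  modulo \<open>2\<pi>\<close> is a periodic function on \<^typ>\<open>real\<close>. The angle of the origin is unspecified.
\<close>

definition polar_angle :: "real \<times> real \<Rightarrow> real" where
  "polar_angle x = (THE \<theta>. \<theta> \<in> {-pi..<pi} \<and> x /\<^sub>R norm x = (cos \<theta>, sin \<theta>))"

text \<open>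
  Interaction potentials take values in \<^typ>\<open>ennreal\<close>, and the singular one is \<open>\<infinity>\<close> at the origin
  (in HOL, \<open>0 powr (-s) = 0\<close>); thus every measure with an atom has infinite energy. For \<open>\<Omega> > 0\<close> the
  embedding \<^const>\<open>ennreal\<close> truncates nothing.
\<close>

definition interaction :: "real \<Rightarrow> (real \<Rightarrow> real) \<Rightarrow> real \<times> real \<Rightarrow> ennreal" where
  "interaction s \<Omega> x =
     (if x = 0 then \<infinity>
      else ennreal (norm x powr (-s) * \<Omega> (polar_angle x) + (norm x)\<^sup>2))"

definition convol :: "(real \<times> real \<Rightarrow> ennreal) \<Rightarrow> (real \<times> real) measure \<Rightarrow> real \<times> real \<Rightarrow> ennreal" where
  "convol W \<rho> x = (\<integral>\<^sup>+ y. W (x - y) \<partial>\<rho>)"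

definition energy :: "(real \<times> real \<Rightarrow> ennreal) \<Rightarrow> (real \<times> real) measure \<Rightarrow> ennreal" where
  "energy W \<rho> = (\<integral>\<^sup>+ x. convol W \<rho> x \<partial>\<rho>) / 2"

definition prob_on_plane :: "(real \<times> real) measure \<Rightarrow> bool" where
  "prob_on_plane \<mu> \<longleftrightarrow> prob_space \<mu> \<and> sets \<mu> = sets borel"

definition couplings ::
  "(real \<times> real) measure \<Rightarrow> (real \<times> real) measure \<Rightarrow> ((real \<times> real) \<times> (real \<times> real)) measure set" where
  "couplings \<mu> \<nu> =
     {\<gamma>. prob_space \<gamma> \<and> sets \<gamma> = sets (borel \<Otimes>\<^sub>M borel) \<and>
         distr \<gamma> borel fst = \<mu> \<and> distr \<gamma> borel snd = \<nu>}"

definition wasserstein_inf :: "(real \<times> real) measure \<Rightarrow> (real \<times> real) measure \<Rightarrow> ennreal" where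
  "wasserstein_inf \<mu> \<nu> = (INF \<gamma>\<in>couplings \<mu> \<nu>. esssup \<gamma> (\<lambda>(x, y). ennreal (dist x y)))"

definition winf_local_minimizer ::
  "(real \<times> real \<Rightarrow> ennreal) \<Rightarrow> (real \<times> real) measure \<Rightarrow> bool" where
  "winf_local_minimizer W \<rho> \<longleftrightarrow>
     (\<exists>\<epsilon>0>0. \<forall>\<rho>'. prob_on_plane \<rho>' \<and> wasserstein_inf \<rho> \<rho>' < ennreal \<epsilon>0
                   \<longrightarrow> energy W \<rho> \<le> energy W \<rho>')"

text \<open>The measure \<open>\<psi>(x\<^sub>2) \<delta>(x\<^sub>1)\<close>, carried by the vertical axis.\<close>

definition vertical_measure :: "(real \<Rightarrow> real) \<Rightarrow> (real \<times> real) measure" where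
  "vertical_measure \<psi> = distr (density lborel (\<lambda>t. ennreal (\<psi> t))) borel (\<lambda>t. (0, t))"

definition tau :: "real \<Rightarrow> real" where
  "tau r = (2 * pi) powr (-r) * Gamma r * cos (r * pi / 2)"

definition cconst :: "real \<Rightarrow> real" where
  "cconst s = pi powr (s - 1) * Gamma ((2 - s) / 2) / Gamma (s / 2)"

text \<open>
  The angular profile of the Fourier transform (normalised with kernel \<open>exp (-2\<pi>i x \<cdot> \<xi>)\<close>):
  the transform of \<open>|x| powr (-s) * \<Omega> \<theta>\<close> is \<open>|\<xi>| powr (s - 2) * Omega_tilde s \<Omega> \<phi>\<close>, for \<open>\<Omega>\<close> smooth
  and \<open>\<pi>\<close>-periodic. Subtracting \<open>\<Omega> (\<phi> + \<pi>/2)\<close> makes the integral absolutely convergent for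
  \<open>0 < s\<close>; at the two zeros of the cosine the integrand is 0.
\<close>

definition Omega_tilde :: "real \<Rightarrow> (real \<Rightarrow> real) \<Rightarrow> real \<Rightarrow> real" where
  "Omega_tilde s \<Omega> \<phi> =
     tau (2 - s) * (LINT \<theta>:{-pi..pi}|lborel.
        \<bar>cos (\<phi> - \<theta>)\<bar> powr (-2 + s) * (\<Omega> \<theta> - \<Omega> (\<phi> + pi / 2)))
     + cconst s * \<Omega> (\<phi> + pi / 2)"

end

theory Submission
  imports Defs "HOL-Real_Asymp.Real_Asymp"
begin

text \<open>
  Because \<open>\<Omega>\<close> has period \<open>\<pi>\<close>, the angular factor of \<open>W\<close> depends only on the slope of its argument, so
  that \<open>W (a, v)\<close> is an explicit function \<open>line_kernel s \<Omega> a v\<close> of two real variables and the potential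
  of \<open>\<rho>\<close> at \<open>(a, b)\<close> is a convolution on the line. By homogeneity (\<open>line_kernel_rescale\<close>) the kernels
  at distance \<open>\<epsilon>\<close> from the axis and on the axis differ, up to the constant \<open>\<epsilon>\<^sup>2\<close>, by
  \<open>\<epsilon> powr (-s) * h (v / \<epsilon>)\<close> for the single function
  \<open>h u = (1 + u\<^sup>2) powr (-s/2) * \<Omega> (arctan u) - \<bar>u\<bar> powr (-s) * \<Omega> (\<pi>/2)\<close>.
  The two parts of \<open>h\<close> cancel to leading order at infinity, because a point far along the axis is seen
  under an angle close to \<open>\<pi>/2\<close>; hence \<open>h\<close> is integrable. Testing with \<open>\<psi>\<close>, which is nearly \<open>\<psi> 0\<close> on
  the scale \<open>\<epsilon>\<close>, gives the main term \<open>\<epsilon> powr (1 - s) * \<psi> 0 * \<integral>h\<close>.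

  The integral of \<open>h\<close> (\<open>integral_line_profile\<close>) is found by separating the value of \<open>\<Omega>\<close> at \<open>\<pi>/2\<close>. The
  substitution \<open>u = tan \<theta>\<close> turns the rest into half of the integral in the definition of
  \<open>Omega_tilde\<close>. What is left is the integral of \<open>(1 + u\<^sup>2) powr (-s/2) - \<bar>u\<bar> powr (-s)\<close>, the analytic
  continuation of a Beta integral; one integration by parts makes it a convergent Beta integral, and the
  duplication and reflection formulas of the Gamma function identify it with \<open>c\<^sub>s / (2 \<tau>)\<close>.

  For the error, \<open>\<psi> (-v) - \<psi> 0 = O(\<bar>v\<bar>)\<close> since \<open>\<psi>\<close> is bounded and differentiable at \<open>0\<close>. The bound
  \<open>\<bar>h u\<bar> \<le> H * \<bar>u\<bar> powr (-s-1)\<close> yields \<open>\<epsilon> powr (-s) * \<bar>h (v / \<epsilon>)\<bar> \<le> H * \<epsilon> * \<bar>v\<bar> powr (-s-1)\<close>, hence an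
  error \<open>O(\<epsilon>)\<close>. If \<open>\<Omega>\<close> has a minimum at \<open>\<pi>/2\<close>, then the first-order term of \<open>\<Omega>\<close> there vanishes, \<open>h\<close>
  decays by one more power, \<open>\<bar>u\<bar> * \<bar>h u\<bar>\<close> is integrable, and the error is \<open>O(\<epsilon> powr (2 - s))\<close>.

  As \<open>\<tau> < 0\<close>, positivity of \<open>Omega_tilde s \<Omega> 0\<close> and \<open>\<psi> 0\<close> makes the potential at \<open>(\<epsilon>, 0)\<close> smaller than
  at the origin for small \<open>\<epsilon>\<close>. Then slide the part of \<open>\<rho>\<close> with \<open>\<bar>x\<^sub>2\<bar> < \<eta>\<close> sideways to \<open>x\<^sub>1 = \<epsilon>\<close>. This
  moves mass by at most \<open>\<epsilon>\<close>. Being a translation, it leaves the energy of the moved segment with itself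
  unchanged, so only the cross terms matter: they gain a fixed amount per unit of moved mass, and lose at
  most the potential of the segment on itself, which tends to \<open>0\<close> with \<open>\<eta>\<close>. For small \<open>\<eta>\<close> the energy
  has strictly decreased (\<open>energy_decreases\<close>).
\<close>

section \<open>Integrals over the line\<close>

lemma integrable_even_half:
  fixes f :: "real \<Rightarrow> real"
  assumes meas: "f \<in> borel_measurable borel"
    and even: "\<And>x. f (- x) = f x"
    and half: "set_integrable lborel {0<..} f"
  shows "integrable lborel f" and "(LINT x|lborel. f x) = 2 * (LINT x:{0<..}|lborel. f x)"
proof -
  define g where "g = (\<lambda>x. indicator {0<..} x * f x)"
  have g: "integrable lborel g"
    using half by (simp add: set_integrable_def g_def)
  have g': "integrable lborel (\<lambda>x. g (- x))"
    using lborel_integrable_real_affine[OF g, of "-1" 0] by simp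
  have ae: "AE x in lborel. g x + g (- x) = f x"
    using AE_lborel_singleton[of "0::real"]
    by eventually_elim (auto simp: g_def even split: split_indicator)
  have m: "f \<in> borel_measurable lborel" using meas by simp
  have i: "integrable lborel (\<lambda>x. g x + g (- x))"
    using g g' by simp
  show "integrable lborel f"
    by (rule Bochner_Integration.integrable_cong_AE_imp[OF i m]) (use ae in auto)
  have "(LINT x|lborel. f x) = (LINT x|lborel. g x + g (- x))"
    by (rule Bochner_Integration.integral_cong_AE) (use ae m i in \<open>auto simp: borel_measurable_integrable\<close>)
  also have "\<dots> = (LINT x|lborel. g x) + (LINT x|lborel. g (- x))"
    using g g' by simp
  also have "(LINT x|lborel. g (- x)) = (LINT x|lborel. g x)"
    using lborel_integral_real_affine[of "-1" g 0] by simp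
  finally show "(LINT x|lborel. f x) = 2 * (LINT x:{0<..}|lborel. f x)"
    by (simp add: g_def set_lebesgue_integral_def)
qed

text \<open>
  The singular integrands below are handled by this comparison: a power less singular than
  \<open>\<bar>u\<bar> powr (-1)\<close> controls the function near \<open>0\<close>, one decaying faster controls it near infinity.
\<close>

lemma integrable_between_powers:
  fixes f :: "real \<Rightarrow> real"
  assumes meas: "f \<in> borel_measurable borel" and a: "a < 1" and b: "1 < b"
    and near: "\<And>u. u \<noteq> 0 \<Longrightarrow> \<bar>f u\<bar> \<le> C * \<bar>u\<bar> powr (- a)"
    and far: "\<And>u. u \<noteq> 0 \<Longrightarrow> \<bar>f u\<bar> \<le> C * \<bar>u\<bar> powr (- b)"
  shows "integrable lborel f"
proof -
  define p where "p = (\<lambda>u::real. if \<bar>u\<bar> \<le> 1 then \<bar>u\<bar> powr (- a) else \<bar>u\<bar> powr (- b))"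
  have pm: "p \<in> borel_measurable borel" unfolding p_def by measurable
  have 1: "(\<lambda>u::real. u powr (- a)) absolutely_integrable_on {0..1}"
    using a by (intro nonnegative_absolutely_integrable_1 integrable_on_powr_from_0) auto
  have 2: "(\<lambda>u::real. u powr (- b)) absolutely_integrable_on {1..}"
    using has_integral_powr_to_inf[of "- b" 1] b
    by (intro nonnegative_absolutely_integrable_1) (auto simp: integrable_on_def)
  have b1: "set_integrable lborel {0<..1} (\<lambda>u::real. u powr (- a))"
  proof -
    have "set_integrable lebesgue {0<..1} (\<lambda>u::real. u powr (- a))"
      by (rule set_integrable_subset[OF 1]) auto
    then show ?thesis
      unfolding set_integrable_def by (subst (asm) integrable_completion) auto
  qed
  have b2: "set_integrable lborel {1<..} (\<lambda>u::real. u powr (- b))"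
  proof -
    have "set_integrable lebesgue {1<..} (\<lambda>u::real. u powr (- b))"
      by (rule set_integrable_subset[OF 2]) auto
    then show ?thesis
      unfolding set_integrable_def by (subst (asm) integrable_completion) auto
  qed
  have 3: "set_integrable lborel {0<..1} p"
    using b1 by (rule set_integrable_cong[THEN iffD1, rotated -1]) (auto simp: p_def)
  have 4: "set_integrable lborel {1<..} p"
    using b2 by (rule set_integrable_cong[THEN iffD1, rotated -1]) (auto simp: p_def)
  have "set_integrable lborel ({0<..1} \<union> {1<..}) p"
    by (intro set_integrable_Un 3 4) auto
  moreover have "{0<..1} \<union> {1<..} = {0::real<..}" by auto
  ultimately have "integrable lborel p"
    by (intro integrable_even_half(1)[OF pm]) (auto simp: p_def)
  then have i: "integrable lborel (\<lambda>u. C * p u)" by simp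
  show ?thesis
  proof (rule Bochner_Integration.integrable_bound[OF i])
    show "f \<in> borel_measurable lborel" using meas by simp
    show "AE u in lborel. norm (f u) \<le> norm (C * p u)"
      using AE_lborel_singleton[of "0::real"]
    proof eventually_elim
      case (elim u)
      then have "\<bar>f u\<bar> \<le> C * p u" using near[of u] far[of u] by (auto simp: p_def)
      then show ?case by simp
    qed
  qed
qed

lemma set_integrable_lborel_if_absolutely_integrable:
  fixes f :: "real \<Rightarrow> real"
  assumes "f \<in> borel_measurable borel" "S \<in> sets borel" "f absolutely_integrable_on S"
  shows "set_integrable lborel S f" "(LINT x:S|lborel. f x) = integral S f"
proof -
  show 1: "set_integrable lborel S f"
    using assms(3) unfolding set_integrable_def
    by (subst (asm) integrable_completion) (use assms in auto)
  show "(LINT x:S|lborel. f x) = integral S f"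
    using set_borel_integral_eq_integral[OF 1] by simp
qed

text \<open>
  The substitution \<open>u = sqrt (t / (1 - t))\<close>, for which \<open>1 + u\<^sup>2 = 1 / (1 - t)\<close>, transforms the
  integral into the standard Beta integral over the unit interval.
\<close>

lemma integral_Beta_half_line:
  fixes s :: real
  assumes s: "-1 < s"
  shows "set_integrable lborel {0<..} (\<lambda>u::real. (1 + u\<^sup>2) powr (- s / 2 - 1))"
    and "(LINT u:{0<..}|lborel. (1 + u\<^sup>2) powr (- s / 2 - 1)) = Beta (1/2) ((s + 1) / 2) / 2"
proof -
  define f where "f = (\<lambda>u::real. (1 + u\<^sup>2) powr (- s / 2 - 1))"
  define g where "g = (\<lambda>t::real. sqrt (t / (1 - t)))"
  define g' where "g' = (\<lambda>t::real. t powr (-1/2) * (1 - t) powr (-3/2) / 2)"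
  have der: "(g has_field_derivative g' t) (at t within {0<..<1})" if "t \<in> {0<..<1}" for t
  proof -
    have t: "0 < t" "t < 1" using that by auto
    have *: "((\<lambda>t. t / (1 - t)) has_field_derivative 1 / (1 - t)^2) (at t)"
      using t by (auto intro!: derivative_eq_intros simp: divide_simps power2_eq_square)
    have "(g has_field_derivative (inverse (sqrt (t / (1 - t))) / 2 * (1 / (1 - t)^2))) (at t)"
      unfolding g_def by (rule DERIV_chain2[OF DERIV_real_sqrt *]) (use t in auto)
    also have "inverse (sqrt (t / (1 - t))) / 2 * (1 / (1 - t)^2) = g' t"
    proof -
      have "(1 - t) powr (-3/2) = (1 - t) powr (1/2) * (1 - t) powr (-2)"
        by (simp flip: powr_add)
      also have "(1 - t) powr (-2) = 1 / (1 - t)^2"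
        using t by (simp add: powr_minus powr_numeral inverse_eq_divide)
      finally have 2: "(1 - t) powr (-3/2) = sqrt (1 - t) / (1 - t)^2"
        using t by (simp add: powr_half_sqrt)
      have "t powr (-1/2) = 1 / sqrt t" using t by (simp add: powr_minus powr_half_sqrt inverse_eq_divide)
      then show ?thesis unfolding g'_def 2 using t by (simp add: real_sqrt_divide field_simps)
    qed
    finally show ?thesis by (rule has_field_derivative_at_within)
  qed
  have sq: "(g t)\<^sup>2 = t / (1 - t)" if "t \<in> {0<..<1}" for t
    using that by (simp add: g_def)
  have inj: "inj_on g {0<..<1}"
  proof (rule inj_onI)
    fix x y :: real assume "x \<in> {0<..<1}" "y \<in> {0<..<1}" "g x = g y"
    then have "x / (1 - x) = y / (1 - y)" using sq by metis
    with \<open>x \<in> _\<close> \<open>y \<in> _\<close> show "x = y" by (simp add: field_simps)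
  qed
  have img: "g ` {0<..<1} = {0<..}"
  proof (intro equalityI subsetI)
    fix u :: real assume "u \<in> {0<..}"
    then have u: "u > 0" by simp
    have p: "1 + u\<^sup>2 > 0" by (smt (verit) zero_le_power2)
    have "1 - u\<^sup>2 / (1 + u\<^sup>2) = 1 / (1 + u\<^sup>2)" using p by (simp add: field_simps)
    then have "g (u\<^sup>2 / (1 + u\<^sup>2)) = sqrt (u\<^sup>2)"
      unfolding g_def using p by simp
    also have "\<dots> = u" using u by simp
    finally have "u = g (u\<^sup>2 / (1 + u\<^sup>2))" by simp
    moreover have "u\<^sup>2 / (1 + u\<^sup>2) \<in> {0<..<1}" using u p by simp
    ultimately show "u \<in> g ` {0<..<1}" by blast
  qed (auto simp: g_def)
  define b where "b = (\<lambda>t::real. t powr (1/2 - 1) * (1 - t) powr ((s + 1) / 2 - 1))"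
  have fg: "\<bar>g' t\<bar> * f (g t) = b t / 2" if "t \<in> {0<..<1}" for t
  proof -
    have t: "0 < t" "t < 1" using that by auto
    have "1 + (g t)\<^sup>2 = 1 / (1 - t)" using sq[OF that] t by (simp add: field_simps)
    then have "f (g t) = (1 - t) powr (s / 2 + 1)"
      using t powr_minus[of "1 - t" "s / 2 + 1"] unfolding f_def by (simp add: powr_divide inverse_eq_divide)
    moreover have "(1 - t) powr (-3/2) * (1 - t) powr (s / 2 + 1) = (1 - t) powr ((s + 1) / 2 - 1)"
    proof -
      have "-3/2 + (s / 2 + 1) = (s + 1) / 2 - 1" by (simp add: field_simps)
      then show ?thesis by (metis powr_add)
    qed
    ultimately show ?thesis unfolding g'_def b_def by (simp add: mult.assoc)
  qed
  have b1: "set_integrable lborel {0<..<1} b"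
    unfolding b_def
    by (rule set_integrable_subset[OF integrable_Beta[of "1/2" "(s+1)/2"]]) (use s in auto)
  have "(b has_integral Beta (1/2) ((s+1)/2)) {0<..<1}"
    using has_integral_Beta_real[of "1/2" "(s+1)/2"] s unfolding b_def
    by (simp add: has_integral_Icc_iff_Ioo)
  then have b2: "((\<lambda>t. b t / 2) has_integral Beta (1/2) ((s+1)/2) / 2) {0<..<1}"
    by (rule has_integral_divide)
  have b2': "((\<lambda>t. \<bar>g' t\<bar> * f (g t)) has_integral Beta (1/2) ((s+1)/2) / 2) {0<..<1}"
    using b2 by (rule has_integral_cong[THEN iffD1, rotated]) (simp add: fg)
  have "(\<lambda>t. \<bar>g' t\<bar> * f (g t)) absolutely_integrable_on {0<..<1}"
    using b2' by (intro nonnegative_absolutely_integrable_1) (auto simp: f_def integrable_on_def)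
  then have "f absolutely_integrable_on (g ` {0<..<1}) \<and> integral (g ` {0<..<1}) f = Beta (1/2) ((s+1)/2) / 2"
    using has_absolute_integral_change_of_variables_1'[of "{0<..<1}" g g' f
      "Beta (1/2) ((s+1)/2) / 2", OF _ der inj]
    by (simp add: integral_unique[OF b2'])
  then have *: "f absolutely_integrable_on {0<..}" "integral {0<..} f = Beta (1/2) ((s+1)/2) / 2"
    by (auto simp: img)
  have m: "f \<in> borel_measurable borel" unfolding f_def by measurable
  from set_integrable_lborel_if_absolutely_integrable[OF m _ *(1)] *(2)
  show "set_integrable lborel {0<..} (\<lambda>u::real. (1 + u\<^sup>2) powr (- s / 2 - 1))"
    "(LINT u:{0<..}|lborel. (1 + u\<^sup>2) powr (- s / 2 - 1)) = Beta (1/2) ((s + 1) / 2) / 2"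
    by (auto simp: f_def)
qed

section \<open>The regularized Beta integral\<close>

lemma abs_powr_eq_square_powr:
  fixes u r :: real
  shows "\<bar>u\<bar> powr r = (u\<^sup>2) powr (r / 2)"
proof -
  have "\<bar>u\<bar> powr r = (\<bar>u\<bar> powr 2) powr (r / 2)" by (simp only: powr_powr) simp
  then show ?thesis by (simp add: powr_numeral)
qed

text \<open>
  Factor \<open>(1 + u\<^sup>2) powr (-s/2) = \<bar>u\<bar> powr (-s) * (1 + 1/u\<^sup>2) powr (-s/2)\<close> and use
  \<open>(1 + x) powr (-s/2) \<ge> 1 / (1 + x) \<ge> 1 - x\<close>. Subtracting \<open>\<bar>u\<bar> powr (-s)\<close> thus improves the decay at
  infinity by two powers.
\<close>

lemma regularized_power_bound:
  fixes s u :: real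
  assumes s: "0 < s" "s < 1" and u: "u \<noteq> 0"
  shows "0 \<le> \<bar>u\<bar> powr (- s) - (1 + u\<^sup>2) powr (- s / 2)"
    and "\<bar>u\<bar> powr (- s) - (1 + u\<^sup>2) powr (- s / 2) \<le> \<bar>u\<bar> powr (- s) * min 1 (1 / u\<^sup>2)"
proof -
  have u2: "u\<^sup>2 > 0" using u by simp
  show "0 \<le> \<bar>u\<bar> powr (- s) - (1 + u\<^sup>2) powr (- s / 2)"
    using powr_mono2'[of "- s / 2" "u\<^sup>2" "1 + u\<^sup>2"] s u2 by (simp add: abs_powr_eq_square_powr)
  have "1 - 1 / u\<^sup>2 \<le> 1 / (1 + 1 / u\<^sup>2)"
  proof -
    have "(1 - x) * (1 + x) \<le> 1" for x :: real by (simp add: algebra_simps)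
    then have "1 - x \<le> 1 / (1 + x)" if "x > 0" for x :: real
      using that by (simp add: pos_le_divide_eq)
    then show ?thesis using u2 by simp
  qed
  also have "\<dots> = (1 + 1 / u\<^sup>2) powr (-1)"
    using u2 by (simp add: powr_minus inverse_eq_divide)
  also have "\<dots> \<le> (1 + 1 / u\<^sup>2) powr (- s / 2)"
    using s u2 by (intro powr_mono) auto
  finally have "\<bar>u\<bar> powr (- s) * (1 - 1 / u\<^sup>2) \<le> \<bar>u\<bar> powr (- s) * (1 + 1 / u\<^sup>2) powr (- s / 2)"
    by (intro mult_left_mono) auto
  also have "\<dots> = (u\<^sup>2 * (1 + 1 / u\<^sup>2)) powr (- s / 2)"
    using u2 by (simp add: abs_powr_eq_square_powr powr_mult)
  also have "u\<^sup>2 * (1 + 1 / u\<^sup>2) = 1 + u\<^sup>2" using u2 by (simp add: algebra_simps)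
  finally have "\<bar>u\<bar> powr (- s) - (1 + u\<^sup>2) powr (- s / 2) \<le> \<bar>u\<bar> powr (- s) * (1 / u\<^sup>2)"
    by (simp add: algebra_simps)
  moreover have "\<bar>u\<bar> powr (- s) - (1 + u\<^sup>2) powr (- s / 2) \<le> \<bar>u\<bar> powr (- s) * 1"
    by simp
  ultimately show "\<bar>u\<bar> powr (- s) - (1 + u\<^sup>2) powr (- s / 2) \<le> \<bar>u\<bar> powr (- s) * min 1 (1 / u\<^sup>2)"
    by (auto simp: min_def)
qed

lemma integrable_regularized_power:
  fixes s :: real
  assumes s: "0 < s" "s < 1"
  shows "integrable lborel (\<lambda>u. (1 + u\<^sup>2) powr (- s / 2) - \<bar>u\<bar> powr (- s))"
proof (rule integrable_between_powers[of _ s "s + 2" 1])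
  fix u :: real assume u: "u \<noteq> 0"
  note b = regularized_power_bound[OF s u]
  have "\<bar>(1 + u\<^sup>2) powr (- s / 2) - \<bar>u\<bar> powr (- s)\<bar> \<le> \<bar>u\<bar> powr (- s) * min 1 (1 / u\<^sup>2)"
    using b by linarith
  moreover have "\<bar>u\<bar> powr (- s) * min 1 (1 / u\<^sup>2) \<le> \<bar>u\<bar> powr (- s) * 1"
    "\<bar>u\<bar> powr (- s) * min 1 (1 / u\<^sup>2) \<le> \<bar>u\<bar> powr (- s) * (1 / u\<^sup>2)"
    by (intro mult_left_mono; simp)+
  moreover have "\<bar>u\<bar> powr (- s) * (1 / u\<^sup>2) = \<bar>u\<bar> powr (- (s + 2))"
  proof -
    have "\<bar>u\<bar> powr (- (s + 2)) = \<bar>u\<bar> powr (- s) * \<bar>u\<bar> powr (-2)" by (simp flip: powr_add)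
    also have "\<bar>u\<bar> powr (-2) = 1 / u\<^sup>2" using u by (simp add: powr_minus powr_numeral inverse_eq_divide)
    finally show ?thesis by simp
  qed
  ultimately show "\<bar>(1 + u\<^sup>2) powr (- s / 2) - \<bar>u\<bar> powr (- s)\<bar> \<le> 1 * \<bar>u\<bar> powr (- s)"
    "\<bar>(1 + u\<^sup>2) powr (- s / 2) - \<bar>u\<bar> powr (- s)\<bar> \<le> 1 * \<bar>u\<bar> powr (- (s + 2))"
    by linarith+
qed (use s in auto)

lemma cos_two_minus_half_pi: "cos ((2 - s) * pi / 2) = - cos (s * pi / 2)" for s :: real
proof -
  have "(2 - s) * pi / 2 = pi - s * pi / 2" by (simp add: field_simps)
  then have "cos ((2 - s) * pi / 2) = cos (pi - s * pi / 2)" by (rule arg_cong)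
  then show ?thesis by (simp only: cos_pi_minus)
qed

lemma tau_neg:
  assumes s: "0 < s" "s < 1"
  shows "tau (2 - s) < 0"
proof -
  have "cos ((2 - s) * pi / 2) = - cos (s * pi / 2)"
    by (rule cos_two_minus_half_pi)
  moreover have "cos (s * pi / 2) > 0"
    using s by (intro cos_gt_zero) (auto simp: field_simps)
  moreover have "Gamma (2 - s) > 0" using s by (intro Gamma_real_pos) auto
  ultimately show ?thesis by (simp add: tau_def mult_less_0_iff)
qed

text \<open>
  Writing both sides with Gamma functions, \<open>\<Gamma>(2 - s)\<close> is expanded by the duplication formula at
  \<open>z = 1 - s/2\<close> and the cosine by the reflection formula at \<open>y = (1 + s)/2\<close>; as \<open>z + 1/2 = (1 - y) + 1\<close>,
  the two leave the same Gamma values on both sides.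
\<close>

lemma cconst_div_tau:
  assumes s: "0 < s" "s < 1"
  shows "cconst s / (2 * tau (2 - s)) = - (s / (1 - s)) * Beta (1/2) ((s + 1) / 2)"
proof -
  have c: "cos ((2 - s) * pi / 2) = - cos (s * pi / 2)"
    by (rule cos_two_minus_half_pi)
  have cpos: "cos (s * pi / 2) > 0"
    using s by (intro cos_gt_zero) (auto simp: field_simps)
  define z where "z = 1 - s / 2"
  have z: "z > 0" "z + 1/2 > 0" "2 * z = 2 - s" using s by (auto simp: z_def)
  have ni: "complex_of_real x \<notin> \<int>\<^sub>\<le>\<^sub>0" if "x > 0" for x
    using that by (auto elim!: nonpos_Ints_cases simp: complex_eq_iff)
  have "complex_of_real z + 1/2 = complex_of_real (z + 1/2)" by simp
  then have "Gamma (complex_of_real z) * Gamma (complex_of_real (z + 1/2)) =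
      exp ((1 - 2 * complex_of_real z) * of_real (ln 2)) * of_real (sqrt pi) * Gamma (2 * complex_of_real z)"
    using Gamma_legendre_duplication[of "complex_of_real z"] ni[of z] ni[of "z + 1/2"] z by simp
  also have "2 * complex_of_real z = complex_of_real (2 - s)" using z(3) by (metis of_real_mult of_real_numeral)
  also have "exp ((1 - complex_of_real (2 - s)) * of_real (ln 2)) = complex_of_real (2 powr (s - 1))"
    by (simp add: powr_def exp_of_real[symmetric])
  finally have "complex_of_real (Gamma z * Gamma (z + 1/2)) = complex_of_real (2 powr (s - 1) * sqrt pi * Gamma (2 - s))"
    by (simp only: Gamma_complex_of_real of_real_mult)
  then have dup: "Gamma z * Gamma (z + 1/2) = 2 powr (s - 1) * sqrt pi * Gamma (2 - s)"
    using of_real_eq_iff by blast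
  define y where "y = (1 + s) / 2"
  have "Gamma (complex_of_real y) * Gamma (1 - complex_of_real y) = of_real pi / sin (of_real pi * of_real y)"
    by (rule Gamma_reflection_complex)
  also have "1 - complex_of_real y = complex_of_real (1 - y)" by simp
  also have "sin (of_real pi * of_real y) = complex_of_real (sin (pi * y))" by (simp flip: sin_of_real)
  finally have "complex_of_real (Gamma y * Gamma (1 - y)) = complex_of_real (pi / sin (pi * y))"
    by (simp only: Gamma_complex_of_real of_real_mult of_real_divide)
  then have "Gamma y * Gamma (1 - y) = pi / sin (pi * y)"
    using of_real_eq_iff by blast
  also have "sin (pi * y) = cos (s * pi / 2)"
  proof -
    have "pi * y = pi / 2 + s * pi / 2" by (simp add: y_def field_simps)
    then show ?thesis by (simp add: sin_add)
  qed
  finally have refl: "Gamma y * Gamma (1 - y) = pi / cos (s * pi / 2)" .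
  have y1: "1 - y = (1 - s) / 2" by (simp add: y_def field_simps)
  have zy: "z + 1/2 = (1 - y) + 1" by (simp add: z_def y_def field_simps)
  have g1: "Gamma (z + 1/2) = (1 - s) / 2 * Gamma (1 - y)"
    unfolding zy using s by (subst Gamma_plus1) (auto simp: y1 elim!: nonpos_Ints_cases)
  have "Beta (1/2) ((s + 1) / 2) = sqrt pi * Gamma y / Gamma (s / 2 + 1)"
  proof -
    have "1/2 + y = s / 2 + 1" by (simp add: y_def field_simps)
    then show ?thesis by (simp add: Beta_def Gamma_one_half_real y_def add.commute)
  qed
  also have "Gamma (s / 2 + 1) = s / 2 * Gamma (s / 2)"
    using s by (subst Gamma_plus1) (auto elim!: nonpos_Ints_cases)
  finally have B: "Beta (1/2) ((s + 1) / 2) = sqrt pi * Gamma y / (s / 2 * Gamma (s / 2))" .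
  have pos: "Gamma (s / 2) > 0" "Gamma (2 - s) > 0" "Gamma z > 0" "Gamma (1 - y) > 0" "Gamma y > 0"
    using s by (intro Gamma_real_pos; simp add: z_def y_def)+
  have e1: "Gamma (2 - s) = Gamma z * ((1 - s) / 2 * Gamma (1 - y)) / (2 powr (s - 1) * sqrt pi)"
    using dup unfolding g1 by (simp add: field_simps)
  have e2: "cos (s * pi / 2) = pi / (Gamma y * Gamma (1 - y))"
    using refl pos cpos by (simp add: field_simps)
  have e3: "(2 * pi) powr (- (2 - s)) = 2 powr (s - 1) / 2 * (pi powr (s - 1) / pi)"
  proof -
    have "(2 * pi) powr (- (2 - s)) = 2 powr (s - 1 - 1) * pi powr (s - 1 - 1)"
      by (subst powr_mult) auto
    then show ?thesis by (simp only: powr_diff) simp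
  qed
  have t: "tau (2 - s) = - (pi powr (s - 1) * Gamma z * (1 - s) / (4 * sqrt pi * Gamma y))"
    unfolding tau_def c e1 e2 e3 using pos by (simp add: field_simps)
  have "(2 - s) / 2 = z" by (simp add: z_def field_simps)
  then have cc: "cconst s = pi powr (s - 1) * Gamma z / Gamma (s / 2)"
    unfolding cconst_def by simp
  define q where "q = 1 - s"
  have q: "q > 0" using s by (simp add: q_def)
  show ?thesis unfolding t cc B q_def[symmetric] using pos s q by (simp add: field_simps)
qed

text \<open>
  The function \<open>F u = u * ((1 + u\<^sup>2) powr (-s/2) - u powr (-s))\<close> vanishes at \<open>0\<close> and at infinity, and
  its derivative is \<open>1 - s\<close> times the integrand plus \<open>s\<close> times \<open>(1 + u\<^sup>2) powr (-s/2-1)\<close>. So the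
  divergent Beta integral is expressed by the convergent one.
\<close>

lemma integral_regularized_power:
  fixes s :: real
  assumes s: "0 < s" "s < 1"
  shows "(LINT u|lborel. (1 + u\<^sup>2) powr (- s / 2) - \<bar>u\<bar> powr (- s)) = cconst s / (2 * tau (2 - s))"
proof -
  define r where "r = (\<lambda>u::real. (1 + u\<^sup>2) powr (- s / 2) - \<bar>u\<bar> powr (- s))"
  define j where "j = (\<lambda>u::real. (1 + u\<^sup>2) powr (- s / 2 - 1))"
  define F where "F = (\<lambda>u::real. u * ((1 + u\<^sup>2) powr (- s / 2) - u powr (- s)))"
  have ri: "integrable lborel r" unfolding r_def by (rule integrable_regularized_power[OF s])
  have rs: "set_integrable lborel {0<..} r"
    using ri unfolding set_integrable_def by (intro integrable_mult_indicator) auto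
  have j: "set_integrable lborel {0<..} j" "(LINT u:{0<..}|lborel. j u) = Beta (1/2) ((s + 1) / 2) / 2"
    unfolding j_def using s by (intro integral_Beta_half_line; simp)+
  have der: "(F has_vector_derivative (1 - s) * r u + s * j u) (at u)" if u: "u > 0" for u
  proof -
    have p: "1 + u\<^sup>2 > 0" by (smt (verit) zero_le_power2)
    have d: "(F has_real_derivative
       ((1 + u\<^sup>2) powr (- s / 2) - u powr (- s)) +
        u * ((- s / 2) * (1 + u\<^sup>2) powr (- s / 2 - 1) * (2 * u) - (- s) * u powr (- s - 1))) (at u)"
      unfolding F_def using u p
      by (auto intro!: derivative_eq_intros simp: field_simps)
    have gen: "(1 + u\<^sup>2) * X - u * Y + u * ((- s / 2) * X * (2 * u) - (- s) * Y) =
        (1 - s) * ((1 + u\<^sup>2) * X - u * Y) + s * X" for X Y :: real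
      by (simp add: field_simps power2_eq_square)
    have a: "(1 + u\<^sup>2) powr (- s / 2) = (1 + u\<^sup>2) * (1 + u\<^sup>2) powr (- s / 2 - 1)"
      using p by (simp add: powr_diff)
    have b: "u powr (- s) = u * u powr (- s - 1)" using u by (simp add: powr_diff)
    have "((1 + u\<^sup>2) powr (- s / 2) - u powr (- s)) +
        u * ((- s / 2) * (1 + u\<^sup>2) powr (- s / 2 - 1) * (2 * u) - (- s) * u powr (- s - 1))
        = (1 - s) * r u + s * j u"
      unfolding r_def j_def a b abs_of_pos[OF u] 
      by (rule gen)
    with d show ?thesis by (simp add: has_real_derivative_iff_has_vector_derivative)
  qed
  have lim0: "(F \<longlongrightarrow> 0) (at_right 0)" and lim1: "(F \<longlongrightarrow> 0) at_top"
    unfolding F_def using s by real_asymp+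
  have "(LBINT u=0..\<infinity>. (1 - s) * r u + s * j u) = 0 - 0"
  proof (rule interval_integral_FTC_integrable[where F = F])
    show "(F has_vector_derivative (1 - s) * r x + s * j x) (at x)" if "0 < ereal x" for x
      using that der by simp
    show "isCont (\<lambda>u. (1 - s) * r u + s * j u) x" if "0 < ereal x" for x
    proof -
      have "1 + x\<^sup>2 \<noteq> 0" by (smt (verit) zero_le_power2)
      then show ?thesis using that unfolding r_def j_def by (intro continuous_intros) auto
    qed
    show "set_integrable lborel (einterval 0 \<infinity>) (\<lambda>u. (1 - s) * r u + s * j u)"
    proof -
      have "einterval 0 \<infinity> = {0::real<..}" by (auto simp: einterval_def)
      then show ?thesis using rs j(1) by simp
    qed
    show "((F \<circ> real_of_ereal) \<longlongrightarrow> 0) (at_right 0)"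
      using lim0 by (simp add: ereal_tendsto_simps zero_ereal_def)
    show "((F \<circ> real_of_ereal) \<longlongrightarrow> 0) (at_left \<infinity>)"
      using lim1 by (simp add: ereal_tendsto_simps)
  qed simp
  then have "0 = (LINT u:{0<..}|lborel. (1 - s) * r u + s * j u)"
    by (simp add: interval_integral_to_infinity_eq zero_ereal_def)
  also have "\<dots> = (1 - s) * (LINT u:{0<..}|lborel. r u) + s * (LINT u:{0<..}|lborel. j u)"
    using rs j(1) by simp
  finally have "(LINT u:{0<..}|lborel. r u) = - (s / (1 - s)) * (Beta (1/2) ((s + 1) / 2) / 2)"
    using s unfolding j(2) by (simp add: field_simps)
  moreover have "(LINT u|lborel. r u) = 2 * (LINT u:{0<..}|lborel. r u)"
    by (rule integrable_even_half(2)[OF _ _ rs]) (auto simp: r_def)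
  ultimately have "(LINT u|lborel. r u) = 2 * (- (s / (1 - s)) * (Beta (1/2) ((s + 1) / 2) / 2))"
    by (simp only:)
  also have "\<dots> = - (s / (1 - s)) * Beta (1/2) ((s + 1) / 2)"
  proof -
    have "2 * (k * (b / 2)) = k * b" for k b :: real by simp
    then show ?thesis by this
  qed
  finally show ?thesis unfolding r_def cconst_div_tau[OF s] .
qed

section \<open>The profile of a line\<close>

text \<open>
  The difference of the singular parts of \<open>W\<close> at the points \<open>(1, u)\<close> and \<open>(0, u)\<close>.
\<close>

definition line_profile :: "real \<Rightarrow> (real \<Rightarrow> real) \<Rightarrow> real \<Rightarrow> real" where
  "line_profile s \<Omega> u = (1 + u\<^sup>2) powr (- s / 2) * \<Omega> (arctan u) - \<bar>u\<bar> powr (- s) * \<Omega> (pi / 2)"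

text \<open>
  Away from \<open>a\<close> the boundedness of \<open>f\<close> gives any power bound for free, so a local one extends. Global
  bounds let the later estimates of integrals avoid a splitting of the domain that depends on \<open>\<epsilon>\<close>.
\<close>

lemma local_power_bound_global:
  fixes f :: "real \<Rightarrow> real"
  assumes bnd: "\<And>x. \<bar>f x\<bar> \<le> M"
    and ev: "\<forall>\<^sub>F x in nhds a. \<bar>f x - f a\<bar> \<le> K * \<bar>x - a\<bar> ^ p"
  obtains C where "C \<ge> 0" "\<And>x. \<bar>f x - f a\<bar> \<le> C * \<bar>x - a\<bar> ^ p"
proof -
  from ev obtain d where d: "d > 0" "\<And>x. \<bar>x - a\<bar> < d \<Longrightarrow> \<bar>f x - f a\<bar> \<le> K * \<bar>x - a\<bar> ^ p"
    unfolding eventually_nhds_metric dist_real_def by blast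
  \<comment> \<open>Outside the ball of radius \<open>d\<close> one has \<open>\<bar>f x - f a\<bar> \<le> 2 * M\<close> and \<open>\<bar>x - a\<bar> ^ p \<ge> d ^ p\<close>.\<close>
  define C where "C = max \<bar>K\<bar> (2 * M / d ^ p)"
  have "\<bar>f x - f a\<bar> \<le> C * \<bar>x - a\<bar> ^ p" for x
  proof (cases "\<bar>x - a\<bar> < d")
    case True
    have "K * \<bar>x - a\<bar> ^ p \<le> C * \<bar>x - a\<bar> ^ p"
      by (rule mult_right_mono) (auto simp: C_def)
    with d(2)[OF True] show ?thesis by linarith
  next
    case False
    have M: "M \<ge> 0" using bnd[of a] by linarith
    have "\<bar>f x - f a\<bar> \<le> 2 * M" using bnd[of a] bnd[of x] by linarith
    also have "\<dots> = (2 * M / d ^ p) * d ^ p" using d by simp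
    also have "\<dots> \<le> C * \<bar>x - a\<bar> ^ p"
      using False d M by (intro mult_mono power_mono) (auto simp: C_def)
    finally show ?thesis .
  qed
  moreover have "C \<ge> 0" by (simp add: C_def)
  ultimately show thesis using that by blast
qed

lemma differentiable_eventually_linear_bound:
  fixes f :: "real \<Rightarrow> real"
  assumes "(f has_real_derivative D) (at a)"
  shows "\<forall>\<^sub>F x in nhds a. \<bar>f x - f a\<bar> \<le> (\<bar>D\<bar> + 1) * \<bar>x - a\<bar> ^ 1"
proof -
  have "((\<lambda>x. (f x - f a) / (x - a)) \<longlongrightarrow> D) (at a)"
    using assms by (simp add: has_field_derivative_iff)
  then have "\<forall>\<^sub>F x in at a. dist ((f x - f a) / (x - a)) D < 1"
    by (rule tendstoD) simp
  then have "\<forall>\<^sub>F x in at a. \<bar>f x - f a\<bar> \<le> (\<bar>D\<bar> + 1) * \<bar>x - a\<bar> ^ 1"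
    using eventually_at_ball[of 1 a UNIV, simplified] eventually_neq_at_within[of a]
  proof eventually_elim
    case (elim x)
    have "\<bar>(f x - f a) / (x - a)\<bar> \<le> \<bar>D\<bar> + 1" using elim(1) unfolding dist_real_def by linarith
    then show ?case using elim(3) by (simp add: abs_divide divide_le_eq)
  qed
  then show ?thesis by (auto simp: eventually_at_filter elim!: eventually_mono)
qed

text \<open>
  The mean value theorem, with the linear bound on \<open>f'\<close> that its vanishing at \<open>a\<close> provides.
\<close>

lemma critical_eventually_quadratic_bound:
  fixes f :: "real \<Rightarrow> real"
  assumes f': "\<And>x. (f has_real_derivative f' x) (at x)"
    and f'': "(f' has_real_derivative D) (at a)" and crit: "f' a = 0"
  shows "\<forall>\<^sub>F x in nhds a. \<bar>f x - f a\<bar> \<le> (\<bar>D\<bar> + 1) * \<bar>x - a\<bar> ^ 2"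
proof -
  obtain d where d: "d > 0" "\<And>x. \<bar>x - a\<bar> < d \<Longrightarrow> \<bar>f' x\<bar> \<le> (\<bar>D\<bar> + 1) * \<bar>x - a\<bar>"
    using differentiable_eventually_linear_bound[OF f''] crit
    unfolding eventually_nhds_metric dist_real_def by auto
  have "\<bar>f x - f a\<bar> \<le> (\<bar>D\<bar> + 1) * \<bar>x - a\<bar> ^ 2" if x: "\<bar>x - a\<bar> < d" for x
  proof (cases "x = a")
    case False
    obtain z where z: "\<bar>z - a\<bar> \<le> \<bar>x - a\<bar>" "f x - f a = (x - a) * f' z"
    proof (cases "a < x")
      case True
      from MVT2[OF True, of f f'] f' obtain z where "a < z" "z < x" "f x - f a = (x - a) * f' z" by blast
      then show ?thesis using that[of z] by auto
    next
      case nless: False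
      then have "x < a" using False by simp
      from MVT2[OF this, of f f'] f' obtain z where "x < z" "z < a" "f a - f x = (a - x) * f' z" by blast
      then show ?thesis using that[of z] by (auto simp: algebra_simps)
    qed
    have "\<bar>f' z\<bar> \<le> (\<bar>D\<bar> + 1) * \<bar>z - a\<bar>" using d(2)[of z] z x by auto
    also have "\<dots> \<le> (\<bar>D\<bar> + 1) * \<bar>x - a\<bar>" using z by (intro mult_left_mono) auto
    finally have "\<bar>x - a\<bar> * \<bar>f' z\<bar> \<le> \<bar>x - a\<bar> * ((\<bar>D\<bar> + 1) * \<bar>x - a\<bar>)"
      by (intro mult_left_mono) auto
    then show ?thesis unfolding z(2) by (simp add: abs_mult power2_eq_square mult_ac)
  qed simp
  then show ?thesis using d(1) unfolding eventually_nhds_metric dist_real_def by blast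
qed

text \<open>
  For \<open>u < 0\<close> the angles \<open>arctan u\<close> and \<open>\<pi>/2 - arctan (1/u)\<close> differ by \<open>\<pi>\<close>. The right-hand side
  shows that both ends of the line correspond to the one angle \<open>\<pi>/2\<close>, approached at rate \<open>1/\<bar>u\<bar>\<close>.
\<close>

lemma pi_periodic_arctan:
  fixes \<Omega> :: "real \<Rightarrow> real"
  assumes per: "\<And>\<theta>. \<Omega> (\<theta> + pi) = \<Omega> \<theta>" and u: "u \<noteq> 0"
  shows "\<Omega> (arctan u) = \<Omega> (pi / 2 - arctan (1 / u))"
proof (cases "u > 0")
  case True
  then show ?thesis using Transcendental.arctan_inverse[OF u] by simp
next
  case False
  then have "pi / 2 - arctan (1 / u) = arctan u + pi"
    using Transcendental.arctan_inverse[OF u] u by (simp add: sgn_if)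
  then show ?thesis using per by simp
qed

lemma pi_periodic_int:
  fixes \<Omega> :: "real \<Rightarrow> real"
  assumes per: "\<And>\<theta>. \<Omega> (\<theta> + pi) = \<Omega> \<theta>"
  shows "\<Omega> (\<theta> + of_int k * pi) = \<Omega> \<theta>"
proof -
  have nat: "\<Omega> (\<theta> + of_nat n * pi) = \<Omega> \<theta>" for \<theta> n
  proof (induction n)
    case (Suc n)
    have "\<Omega> (\<theta> + of_nat (Suc n) * pi) = \<Omega> ((\<theta> + of_nat n * pi) + pi)" by (simp add: algebra_simps)
    then show ?case using Suc per by simp
  qed simp
  show ?thesis
  proof (cases "k \<ge> 0")
    case True
    then show ?thesis using nat[of \<theta> "nat k"] by simp
  next
    case False
    then show ?thesis using nat[of "\<theta> + of_int k * pi" "nat (- k)"] by simp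
  qed
qed

lemma pi_periodic_bounded:
  fixes \<Omega> :: "real \<Rightarrow> real"
  assumes per: "\<And>\<theta>. \<Omega> (\<theta> + pi) = \<Omega> \<theta>" and cont: "continuous_on UNIV \<Omega>"
  obtains M where "\<And>\<theta>. \<bar>\<Omega> \<theta>\<bar> \<le> M"
proof -
  have "compact (\<Omega> ` {0..pi})"
    by (intro compact_continuous_image continuous_on_subset[OF cont]) auto
  then have "bounded (\<Omega> ` {0..pi})" by (rule compact_imp_bounded)
  then obtain M where M: "\<And>\<theta>. \<theta> \<in> {0..pi} \<Longrightarrow> \<bar>\<Omega> \<theta>\<bar> \<le> M"
    unfolding bounded_iff real_norm_def by blast
  have "\<bar>\<Omega> \<theta>\<bar> \<le> M" for \<theta>
  proof -
    define t where "t = \<theta> - of_int \<lfloor>\<theta> / pi\<rfloor> * pi"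
    have "t \<ge> 0" unfolding t_def
      using of_int_floor_le[of "\<theta> / pi"]
      by (simp only: pos_le_divide_eq[OF pi_gt_zero] diff_ge_0_iff_ge)
    moreover have "\<theta> / pi < of_int \<lfloor>\<theta> / pi\<rfloor> + 1" by linarith
    then have "t \<le> pi" unfolding t_def by (simp add: pos_divide_less_eq algebra_simps)
    moreover have "\<Omega> t = \<Omega> \<theta>"
      using pi_periodic_int[of \<Omega> t "\<lfloor>\<theta> / pi\<rfloor>", OF per] by (simp add: t_def)
    ultimately show ?thesis using M[of t] by simp
  qed
  then show thesis using that by blast
qed

text \<open>
  In \<open>h u = (1 + u\<^sup>2) powr (-s/2) * (\<Omega> (arctan u) - \<Omega> (\<pi>/2)) - \<Omega> (\<pi>/2) * (\<bar>u\<bar> powr (-s) - (1 + u\<^sup>2) powr (-s/2))\<close>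
  the first term gains \<open>\<bar>u\<bar> powr (-p)\<close> from the flatness of \<open>\<Omega>\<close> at \<open>\<pi>/2\<close>, the second gains two powers;
  this is the reason for \<open>p \<le> 2\<close>.
\<close>

lemma line_profile_bound:
  fixes \<Omega> :: "real \<Rightarrow> real"
  assumes s: "0 < s" "s < 1" and p: "p = 1 \<or> p = 2"
    and per: "\<And>\<theta>. \<Omega> (\<theta> + pi) = \<Omega> \<theta>"
    and M: "\<And>\<theta>. \<bar>\<Omega> \<theta>\<bar> \<le> M"
    and C: "C \<ge> 0" "\<And>\<theta>. \<bar>\<Omega> \<theta> - \<Omega> (pi / 2)\<bar> \<le> C * \<bar>\<theta> - pi / 2\<bar> ^ p"
  obtains K where "K \<ge> 0" "\<And>u. u \<noteq> 0 \<Longrightarrow> \<bar>line_profile s \<Omega> u\<bar> \<le> K * \<bar>u\<bar> powr (- s)"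
    "\<And>u. u \<noteq> 0 \<Longrightarrow> \<bar>line_profile s \<Omega> u\<bar> \<le> K * \<bar>u\<bar> powr (- (s + real p))"
proof -
  define K where "K = 3 * M + C"
  have M0: "M \<ge> 0" using M[of 0] by linarith
  have *: "\<bar>line_profile s \<Omega> u\<bar> \<le> K * \<bar>u\<bar> powr (- s) \<and>
      \<bar>line_profile s \<Omega> u\<bar> \<le> K * \<bar>u\<bar> powr (- (s + real p))" if u: "u \<noteq> 0" for u
  proof -
    define P where "P = \<bar>u\<bar> powr (- s)"
    define Q where "Q = (1 + u\<^sup>2) powr (- s / 2)"
    define d where "d = \<Omega> (arctan u) - \<Omega> (pi / 2)"
    note b = regularized_power_bound[OF s u, folded P_def Q_def]
    have PQ: "P \<ge> 0" "Q \<ge> 0" by (auto simp: P_def Q_def)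
    have split: "line_profile s \<Omega> u = Q * d - \<Omega> (pi / 2) * (P - Q)"
      by (simp add: line_profile_def P_def Q_def d_def algebra_simps)
    have "\<bar>line_profile s \<Omega> u\<bar> \<le> \<bar>Q * d\<bar> + \<bar>\<Omega> (pi / 2) * (P - Q)\<bar>"
      unfolding split by (rule abs_triangle_ineq4)
    also have "\<dots> \<le> P * \<bar>d\<bar> + M * (P * min 1 (1 / u\<^sup>2))"
      unfolding abs_mult using b PQ M M0 by (intro add_mono mult_mono) auto
    finally have 1: "\<bar>line_profile s \<Omega> u\<bar> \<le> P * \<bar>d\<bar> + M * (P * min 1 (1 / u\<^sup>2))" .
    have d1: "\<bar>d\<bar> \<le> 2 * M" using M[of "arctan u"] M[of "pi / 2"] by (simp add: d_def)
    have "\<bar>d\<bar> \<le> C * \<bar>arctan (1 / u)\<bar> ^ p"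
      using C(2)[of "pi / 2 - arctan (1 / u)"] by (simp add: d_def pi_periodic_arctan[of \<Omega>, OF per u])
    also have "\<dots> \<le> C * \<bar>1 / u\<bar> ^ p"
      using C(1) by (intro mult_left_mono power_mono abs_arctan_le) auto
    finally have d2: "\<bar>d\<bar> \<le> C * (1 / \<bar>u\<bar> ^ p)" by (simp add: power_divide)
    have m: "min 1 (1 / u\<^sup>2) \<le> 1 / \<bar>u\<bar> ^ p"
    proof (cases "\<bar>u\<bar> \<le> 1")
      case True
      then have "\<bar>u\<bar> ^ p \<le> 1" by (intro power_le_one) auto
      then show ?thesis using u by (simp add: min_def field_simps)
    next
      case False
      then have "\<bar>u\<bar> ^ p \<le> \<bar>u\<bar> ^ 2" using p by (intro power_increasing) auto
      then have "1 / u\<^sup>2 \<le> 1 / \<bar>u\<bar> ^ p" using u by (simp add: frac_le)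
      then show ?thesis by simp
    qed
    have "P * \<bar>d\<bar> + M * (P * min 1 (1 / u\<^sup>2)) \<le> P * (2 * M) + M * (P * 1)"
      using d1 PQ M0 by (intro add_mono mult_left_mono) auto
    also have "\<dots> \<le> K * P" using PQ C(1) by (simp add: K_def algebra_simps)
    finally have 2: "\<bar>line_profile s \<Omega> u\<bar> \<le> K * P" using 1 by linarith
    have "P * \<bar>d\<bar> + M * (P * min 1 (1 / u\<^sup>2)) \<le> P * (C * (1 / \<bar>u\<bar> ^ p)) + M * (P * (1 / \<bar>u\<bar> ^ p))"
      using d2 m PQ M0 by (intro add_mono mult_left_mono) auto
    also have "\<dots> = (C + M) * (P * (1 / \<bar>u\<bar> ^ p))" by (simp add: algebra_simps add_divide_distrib)
    also have "\<dots> \<le> K * (P * (1 / \<bar>u\<bar> ^ p))"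
      using PQ M0 by (intro mult_right_mono) (auto simp: K_def)
    also have "P * (1 / \<bar>u\<bar> ^ p) = \<bar>u\<bar> powr (- (s + real p))"
    proof -
      have "\<bar>u\<bar> powr (- (s + real p)) = P * \<bar>u\<bar> powr (- real p)" by (simp add: P_def flip: powr_add)
      also have "\<bar>u\<bar> powr (- real p) = 1 / \<bar>u\<bar> ^ p"
        using u by (simp add: powr_minus powr_realpow inverse_eq_divide)
      finally show ?thesis by simp
    qed
    finally show ?thesis using 1 2 unfolding P_def by linarith
  qed
  show thesis by (rule that[of K]) (use * M0 C in \<open>auto simp: K_def\<close>)
qed

text \<open>
  Under \<open>u = tan \<theta>\<close> the weight \<open>(1 + u\<^sup>2) powr (-s/2)\<close> together with the Jacobian \<open>(cos \<theta>) powr (-2)\<close>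
  becomes \<open>(cos \<theta>) powr (s - 2)\<close>, the weight in \<open>Omega_tilde\<close>. The line covers a half circle, and by
  periodicity the full circle contributes exactly twice as much.
\<close>

lemma integral_line_profile:
  fixes \<Omega> :: "real \<Rightarrow> real"
  assumes s: "0 < s" "s < 1"
    and cont: "continuous_on UNIV \<Omega>" and per: "\<And>\<theta>. \<Omega> (\<theta> + pi) = \<Omega> \<theta>"
    and h: "integrable lborel (line_profile s \<Omega>)"
  shows "(LINT u|lborel. line_profile s \<Omega> u) = 1 / (2 * tau (2 - s)) * Omega_tilde s \<Omega> 0"
proof -
  define \<omega> where "\<omega> = \<Omega> (pi / 2)"
  define r where "r = (\<lambda>u::real. (1 + u\<^sup>2) powr (- s / 2) - \<bar>u\<bar> powr (- s))"
  define f where "f = (\<lambda>u. (1 + u\<^sup>2) powr (- s / 2) * (\<Omega> (arctan u) - \<omega>))"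
  define q where "q = (\<lambda>\<theta>. \<bar>cos \<theta>\<bar> powr (- 2 + s) * (\<Omega> \<theta> - \<omega>))"
  have [measurable]: "\<Omega> \<in> borel_measurable borel"
    using cont by (rule borel_measurable_continuous_onI)
  have ri: "integrable lborel r" unfolding r_def by (rule integrable_regularized_power[OF s])
  have split: "line_profile s \<Omega> u = f u + \<omega> * r u" for u
  proof -
    have "A * x - B * w = A * (x - w) + w * (A - B)" for A B x w :: real by (simp add: algebra_simps)
    then show ?thesis unfolding line_profile_def f_def r_def \<omega>_def by this
  qed
  have R: "(LINT u|lborel. r u) = cconst s / (2 * tau (2 - s))"
    unfolding r_def by (rule integral_regularized_power[OF s])
  have "integrable lborel (\<lambda>u. line_profile s \<Omega> u - \<omega> * r u)"
    by (intro Bochner_Integration.integrable_diff h integrable_mult_right ri)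
  then have fi: "integrable lborel f" unfolding split by simp
  have 1: "(LINT u|lborel. line_profile s \<Omega> u) = (LINT u|lborel. f u) + \<omega> * (cconst s / (2 * tau (2 - s)))"
    unfolding split using fi ri by (simp add: R)
  let ?S = "{- (pi / 2) <..< pi / 2}"
  have fUN: "f absolutely_integrable_on UNIV" "integral UNIV f = (LINT u|lborel. f u)"
    using fi integral_lborel[OF fi] integrable_completion[of f lborel]
    by (auto simp: set_integrable_def f_def)
  have img: "tan ` ?S = UNIV"
  proof (intro equalityI subsetI)
    fix y :: real assume "y \<in> UNIV"
    show "y \<in> tan ` ?S"
    proof (rule image_eqI)
      show "y = tan (arctan y)" by (simp only: tan_arctan)
      show "arctan y \<in> ?S" using arctan_bounded[of y] by simp
    qed
  qed simp
  have inj: "inj_on tan ?S"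
  proof (rule inj_on_inverseI)
    show "arctan (tan x) = x" if "x \<in> ?S" for x using that by (intro arctan_tan) auto
  qed
  have der: "(tan has_field_derivative inverse ((cos \<theta>)\<^sup>2)) (at \<theta> within ?S)" if "\<theta> \<in> ?S" for \<theta>
  proof -
    have "cos \<theta> > 0" using that by (intro cos_gt_zero_pi) auto
    then show ?thesis by (intro has_field_derivative_at_within[OF DERIV_tan]) simp
  qed
  have qf: "\<bar>inverse ((cos \<theta>)\<^sup>2)\<bar> * f (tan \<theta>) = q \<theta>" if "\<theta> \<in> ?S" for \<theta>
  proof -
    have c: "cos \<theta> > 0" using that by (intro cos_gt_zero_pi) auto
    have "1 + (tan \<theta>)\<^sup>2 = (cos \<theta>) powr (-2)"
      using tan_sec[of \<theta>] c by (simp add: powr_minus powr_numeral power_inverse)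
    then have "(1 + (tan \<theta>)\<^sup>2) powr (- s / 2) = (cos \<theta>) powr s"
      by (simp add: powr_powr)
    moreover have "inverse ((cos \<theta>)\<^sup>2) = (cos \<theta>) powr (-2)"
      using c by (simp add: powr_minus powr_numeral)
    moreover have "cos \<theta> powr (-2) * cos \<theta> powr s = cos \<theta> powr (-2 + s)"
      by (simp flip: powr_add)
    moreover have "arctan (tan \<theta>) = \<theta>" using that by (intro arctan_tan) auto
    ultimately show ?thesis unfolding f_def q_def using c by (simp add: mult.assoc[symmetric])
  qed
  have "(\<lambda>\<theta>. \<bar>inverse ((cos \<theta>)\<^sup>2)\<bar> * f (tan \<theta>)) absolutely_integrable_on ?S \<and>
      integral ?S (\<lambda>\<theta>. \<bar>inverse ((cos \<theta>)\<^sup>2)\<bar> * f (tan \<theta>)) = (LINT u|lborel. f u)"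
    by (subst has_absolute_integral_change_of_variables_1'[OF _ der inj]) (use fUN img in auto)
  moreover have "(\<lambda>\<theta>. \<bar>inverse ((cos \<theta>)\<^sup>2)\<bar> * f (tan \<theta>)) absolutely_integrable_on ?S \<longleftrightarrow>
      q absolutely_integrable_on ?S"
    by (rule set_integrable_cong[OF refl refl qf])
  moreover have "integral ?S (\<lambda>\<theta>. \<bar>inverse ((cos \<theta>)\<^sup>2)\<bar> * f (tan \<theta>)) = integral ?S q"
    by (rule Henstock_Kurzweil_Integration.integral_cong) (rule qf)
  ultimately have q: "q absolutely_integrable_on ?S" "integral ?S q = (LINT u|lborel. f u)"
    by auto
  have qm: "q \<in> borel_measurable borel" unfolding q_def by measurable
  note q' = set_integrable_lborel_if_absolutely_integrable[OF qm _ q(1), simplified q(2), simplified]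
  \<comment> \<open>The two halves of the interval are kept apart since they move in opposite directions
    when the half circle is completed to \<open>[-\<pi>, \<pi>]\<close>.\<close>
  define A1 where "A1 = (\<lambda>\<theta>. indicator {0<..<pi / 2} \<theta> * q \<theta>)"
  define A2 where "A2 = (\<lambda>\<theta>. indicator {- (pi / 2)<..<0} \<theta> * q \<theta>)"
  have A1: "integrable lborel A1"
  proof -
    have "set_integrable lborel {0<..<pi / 2} q"
      by (rule set_integrable_subset[OF q'(1)]) (use pi_gt_zero in auto)
    then show ?thesis by (simp add: A1_def set_integrable_def)
  qed
  have A2: "integrable lborel A2"
  proof -
    have "set_integrable lborel {- (pi / 2)<..<0} q"
      by (rule set_integrable_subset[OF q'(1)]) (use pi_gt_zero in auto)
    then show ?thesis by (simp add: A2_def set_integrable_def)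
  qed
  have A1': "integrable lborel (\<lambda>\<theta>. A1 (\<theta> + pi))" "(LINT \<theta>|lborel. A1 (\<theta> + pi)) = (LINT \<theta>|lborel. A1 \<theta>)"
    using lborel_integrable_real_affine[OF A1, of 1 pi] lborel_integral_real_affine[of 1 A1 pi]
    by (auto simp: add.commute)
  have A2': "integrable lborel (\<lambda>\<theta>. A2 (\<theta> - pi))" "(LINT \<theta>|lborel. A2 (\<theta> - pi)) = (LINT \<theta>|lborel. A2 \<theta>)"
    using lborel_integrable_real_affine[OF A2, of 1 "- pi"] lborel_integral_real_affine[of 1 A2 "- pi"]
    by (auto simp: algebra_simps)
  have qp: "q (\<theta> + pi) = q \<theta>" for \<theta> by (simp add: q_def per)
  have qp': "q (\<theta> - pi) = q \<theta>" for \<theta> using qp[of "\<theta> - pi"] by simp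
  \<comment> \<open>The end points of the pieces, where the indicator functions do not match.\<close>
  have nn: "AE \<theta> in lborel. \<theta> \<notin> {-pi, -(pi/2), 0, pi/2, pi::real}"
    by (intro AE_not_in finite_imp_null_set_lborel) auto
  have "(LINT \<theta>:?S|lborel. q \<theta>) = (LINT \<theta>|lborel. A1 \<theta> + A2 \<theta>)"
    unfolding set_lebesgue_integral_def
  proof (rule Bochner_Integration.integral_cong_AE)
    show "AE \<theta> in lborel. indicator ?S \<theta> *\<^sub>R q \<theta> = A1 \<theta> + A2 \<theta>"
      using nn by eventually_elim (auto simp: A1_def A2_def split: split_indicator)
  qed (use qm in \<open>auto simp: A1_def A2_def\<close>)
  also have "\<dots> = (LINT \<theta>|lborel. A1 \<theta>) + (LINT \<theta>|lborel. A2 \<theta>)" using A1 A2 by simp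
  finally have S: "(LINT u|lborel. f u) = (LINT \<theta>|lborel. A1 \<theta>) + (LINT \<theta>|lborel. A2 \<theta>)"
    using q'(2) by simp
  have "(LINT \<theta>:{-pi..pi}|lborel. q \<theta>) = (LINT \<theta>|lborel. (A1 \<theta> + A2 \<theta>) + (A1 (\<theta> + pi) + A2 (\<theta> - pi)))"
    unfolding set_lebesgue_integral_def
  proof (rule Bochner_Integration.integral_cong_AE)
    show "AE \<theta> in lborel. indicator {-pi..pi} \<theta> *\<^sub>R q \<theta> = (A1 \<theta> + A2 \<theta>) + (A1 (\<theta> + pi) + A2 (\<theta> - pi))"
      using nn by eventually_elim (auto simp: A1_def A2_def qp qp' split: split_indicator)
  qed (use qm in \<open>auto simp: A1_def A2_def\<close>)
  also have "\<dots> = 2 * (LINT u|lborel. f u)" using A1 A2 A1' A2' S by simp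
  finally have 2: "(LINT u|lborel. f u) = (LINT \<theta>:{-pi..pi}|lborel. q \<theta>) / 2" by simp
  have "Omega_tilde s \<Omega> 0 = tau (2 - s) * (LINT \<theta>:{-pi..pi}|lborel. q \<theta>) + cconst s * \<omega>"
    by (simp add: Omega_tilde_def q_def \<omega>_def)
  moreover have "tau (2 - s) \<noteq> 0" using tau_neg[OF s] by simp
  ultimately show ?thesis unfolding 1 2 by (simp add: field_simps)
qed

section \<open>The interaction in the coordinates of the line\<close>

text \<open>
  The value of \<open>W\<close> at \<open>(a, v)\<close>, by \<open>interaction_line_kernel\<close>, with a finite placeholder at the origin.
\<close>

definition line_kernel :: "real \<Rightarrow> (real \<Rightarrow> real) \<Rightarrow> real \<Rightarrow> real \<Rightarrow> real" where
  "line_kernel s \<Omega> a v =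
     (a\<^sup>2 + v\<^sup>2) powr (- s / 2) * \<Omega> (if a = 0 then pi / 2 else arctan (v / a)) + (a\<^sup>2 + v\<^sup>2)"

text \<open>
  The description defining \<open>polar_angle\<close> is satisfied by exactly one number: two angles with equal sine
  and cosine differ by a multiple of \<open>2\<pi>\<close>, and the interval is half open of that length.
\<close>

lemma polar_angle_cos_sin:
  fixes x :: "real \<times> real"
  assumes "x \<noteq> 0"
  shows "x /\<^sub>R norm x = (cos (polar_angle x), sin (polar_angle x))"
proof -
  obtain a v where x: "x = (a, v)" by (cases x)
  define n where "n = norm x"
  have n: "n > 0" using assms by (simp add: n_def)
  have "a\<^sup>2 + v\<^sup>2 = n\<^sup>2" by (simp add: n_def x norm_prod_def)
  then have "(a / n)\<^sup>2 + (v / n)\<^sup>2 = 1"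
    using n by (simp add: power_divide add_divide_distrib[symmetric])
  then obtain t where t: "0 \<le> t" "t < 2 * pi" "a / n = cos t" "v / n = sin t"
    using sincos_total_2pi by metis
  \<comment> \<open>From \<open>[0, 2\<pi>)\<close> to the interval \<open>[-\<pi>, \<pi>)\<close>.\<close>
  define \<theta> where "\<theta> = (if t < pi then t else t - 2 * pi)"
  have \<theta>: "\<theta> \<in> {-pi..<pi}" "cos \<theta> = cos t" "sin \<theta> = sin t"
    using t by (auto simp: \<theta>_def cos_diff sin_diff)
  have "\<theta> \<in> {-pi..<pi} \<and> x /\<^sub>R norm x = (cos \<theta>, sin \<theta>)"
    using \<theta> t by (simp add: x n_def[unfolded x, symmetric] divide_inverse mult.commute)
  moreover have "\<phi> = \<theta>" if "\<phi> \<in> {-pi..<pi} \<and> x /\<^sub>R norm x = (cos \<phi>, sin \<phi>)" for \<phi>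
  proof -
    have "sin \<phi> = sin \<theta> \<and> cos \<phi> = cos \<theta>" using that calculation by auto
    then obtain k :: int where k: "\<phi> = \<theta> + 2 * pi * k" unfolding sin_cos_eq_iff by blast
    have "\<bar>\<phi> - \<theta>\<bar> < 2 * pi" using that \<theta> by auto
    then have "2 * pi * \<bar>real_of_int k\<bar> < 2 * pi * 1" using k by (simp add: abs_mult)
    then have "\<bar>real_of_int k\<bar> < 1" using mult_less_cancel_left_pos[of "2 * pi"] pi_gt_zero by simp
    then have "k = 0" by linarith
    with k show ?thesis by simp
  qed
  ultimately have "polar_angle x = \<theta>" unfolding polar_angle_def by (intro the_equality) blast+
  then show ?thesis using \<open>\<theta> \<in> _ \<and> _\<close> by simp
qed

lemma pi_periodic_polar_angle:
  fixes \<Omega> :: "real \<Rightarrow> real"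
  assumes per: "\<And>\<theta>. \<Omega> (\<theta> + pi) = \<Omega> \<theta>" and nz: "(a, v) \<noteq> 0"
  shows "\<Omega> (polar_angle (a, v)) = \<Omega> (if a = 0 then pi / 2 else arctan (v / a))"
proof -
  define \<phi> where "\<phi> = polar_angle (a, v)"
  define n where "n = norm (a, v)"
  have n: "n > 0" using nz by (simp add: n_def)
  have cs: "a / n = cos \<phi>" "v / n = sin \<phi>"
    using polar_angle_cos_sin[OF nz, folded \<phi>_def n_def] by (auto simp: divide_inverse mult.commute)
  show ?thesis
  proof (cases "a = 0")
    case True
    then have "cos \<phi> = 0" using cs by simp
    then obtain k :: int where "\<phi> = of_int k * pi + pi / 2" unfolding cos_zero_iff_int2 by blast
    then show ?thesis using True pi_periodic_int[of \<Omega> "pi / 2" k, OF per] by (simp add: \<phi>_def add.commute)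
  next
    case False
    then have c: "cos \<phi> \<noteq> 0" using cs n by auto
    have "tan \<phi> = v / a" unfolding tan_def cs[symmetric] using n by simp
    with arctan_tan_eq_abs_pi[OF c] obtain k where "arctan (v / a) = \<phi> - of_int k * pi" by metis
    then have "\<phi> = arctan (v / a) + of_int k * pi" by simp
    then show ?thesis using False pi_periodic_int[of \<Omega> "arctan (v / a)" k, OF per] by (simp add: \<phi>_def)
  qed
qed

text \<open>
  The axis \<open>a = 0\<close> has to be treated separately because its slope is not a real number (in HOL,
  \<open>v / 0 = 0\<close>).
\<close>

lemma interaction_line_kernel:
  fixes \<Omega> :: "real \<Rightarrow> real"
  assumes per: "\<And>\<theta>. \<Omega> (\<theta> + pi) = \<Omega> \<theta>"
  shows "interaction s \<Omega> (a, v) = (if a = 0 \<and> v = 0 then \<infinity> else ennreal (line_kernel s \<Omega> a v))"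
proof (cases "(a, v) = 0")
  case True
  then show ?thesis by (simp add: interaction_def zero_prod_def)
next
  case False
  have sq: "(norm (a, v))\<^sup>2 = a\<^sup>2 + v\<^sup>2" by (simp add: norm_prod_def)
  have "norm (a, v) powr (- s) = (a\<^sup>2 + v\<^sup>2) powr (- s / 2)"
    using abs_powr_eq_square_powr[of "norm (a, v)" "- s"] by (simp only: sq abs_norm_cancel)
  then have "interaction s \<Omega> (a, v) = ennreal (line_kernel s \<Omega> a v)"
    using False unfolding interaction_def sq pi_periodic_polar_angle[of \<Omega>, OF per False]
    by (simp add: line_kernel_def)
  then show ?thesis using False by (auto simp: zero_prod_def)
qed

lemma line_kernel_minus: "line_kernel s \<Omega> (- a) (- v) = line_kernel s \<Omega> a v"
  by (simp add: line_kernel_def)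

lemma line_kernel_rescale:
  assumes \<epsilon>: "\<epsilon> > 0"
  shows "line_kernel s \<Omega> \<epsilon> v - line_kernel s \<Omega> 0 v = \<epsilon> powr (- s) * line_profile s \<Omega> (v / \<epsilon>) + \<epsilon>\<^sup>2"
proof -
  have e: "\<epsilon> powr (- s) = (\<epsilon>\<^sup>2) powr (- s / 2)" using abs_powr_eq_square_powr[of \<epsilon> "- s"] \<epsilon> by simp
  have "\<epsilon> powr (- s) * (1 + (v / \<epsilon>)\<^sup>2) powr (- s / 2) = (\<epsilon>\<^sup>2 * (1 + (v / \<epsilon>)\<^sup>2)) powr (- s / 2)"
    unfolding e by (rule powr_mult[symmetric]) 
  also have "\<epsilon>\<^sup>2 * (1 + (v / \<epsilon>)\<^sup>2) = \<epsilon>\<^sup>2 + v\<^sup>2" using \<epsilon> by (simp add: field_simps power_divide)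
  finally have 1: "\<epsilon> powr (- s) * (1 + (v / \<epsilon>)\<^sup>2) powr (- s / 2) = (\<epsilon>\<^sup>2 + v\<^sup>2) powr (- s / 2)" .
  have "\<epsilon> powr (- s) * \<bar>v / \<epsilon>\<bar> powr (- s) = (\<epsilon> * \<bar>v / \<epsilon>\<bar>) powr (- s)"
    using \<epsilon> by (intro powr_mult[symmetric]) 
  also have "\<epsilon> * \<bar>v / \<epsilon>\<bar> = \<bar>v\<bar>" using \<epsilon> by (simp add: abs_divide)
  finally have 2: "\<epsilon> powr (- s) * \<bar>v / \<epsilon>\<bar> powr (- s) = (v\<^sup>2) powr (- s / 2)"
    unfolding abs_powr_eq_square_powr[of v] .
  show ?thesis
    unfolding line_kernel_def line_profile_def right_diff_distrib mult.assoc[symmetric] 1 2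
    using \<epsilon> by simp
qed

lemma line_kernel_bound:
  assumes s: "0 < s" and M: "\<And>\<theta>. \<bar>\<Omega> \<theta>\<bar> \<le> M" and v: "v \<noteq> 0"
  shows "\<bar>line_kernel s \<Omega> a v\<bar> \<le> M * \<bar>v\<bar> powr (- s) + (a\<^sup>2 + v\<^sup>2)"
proof -
  have M0: "M \<ge> 0" using M[of 0] by linarith
  have "(a\<^sup>2 + v\<^sup>2) powr (- s / 2) \<le> (v\<^sup>2) powr (- s / 2)"
    using s v by (intro powr_mono2') auto
  then have "\<bar>(a\<^sup>2 + v\<^sup>2) powr (- s / 2) * \<Omega> (if a = 0 then pi / 2 else arctan (v / a))\<bar>
      \<le> (v\<^sup>2) powr (- s / 2) * M"
    unfolding abs_mult using M by (intro mult_mono) auto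
  then show ?thesis unfolding line_kernel_def abs_powr_eq_square_powr[of v]
    by (smt (verit, best) mult.commute zero_le_power2)
qed

lemma measurable_line_kernel [measurable]:
  assumes [measurable]: "\<Omega> \<in> borel_measurable borel" "f \<in> borel_measurable M" "g \<in> borel_measurable M"
  shows "(\<lambda>x. line_kernel s \<Omega> (f x) (g x)) \<in> borel_measurable M"
proof -
  have [measurable]: "(arctan :: real \<Rightarrow> real) \<in> borel_measurable borel"
    by (intro borel_measurable_continuous_onI continuous_intros)
  show ?thesis unfolding line_kernel_def by measurable
qed

text \<open>
  On a bounded interval the quadratic confinement is at most a multiple of \<open>\<bar>v\<bar> powr (-s)\<close>, and
  \<open>\<bar>v\<bar> powr (-s)\<close> is at most a multiple of \<open>\<bar>v\<bar> powr (-s-2)\<close>, which makes the comparison with powers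
  applicable.
\<close>

lemma line_kernel_locally_integrable:
  assumes s: "0 < s" "s < 1" and M: "\<And>\<theta>. \<bar>\<Omega> \<theta>\<bar> \<le> M"
    and [measurable]: "\<Omega> \<in> borel_measurable borel" 
  shows "integrable lborel (\<lambda>v. indicator {- R..R} v * line_kernel s \<Omega> a v)"
proof -
  define S where "S = max R 1"
  have S: "S \<ge> 1" "S \<ge> R" by (auto simp: S_def)
  have M0: "M \<ge> 0" using M[of 0] by linarith
  define K where "K = (M + (a\<^sup>2 + S\<^sup>2) * S) * S\<^sup>2"
  have K1: "M + (a\<^sup>2 + S\<^sup>2) * S \<ge> 0" using M0 S by simp
  have *: "\<bar>indicator {- R..R} v * line_kernel s \<Omega> a v\<bar> \<le> K * \<bar>v\<bar> powr (- s) \<and>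
      \<bar>indicator {- R..R} v * line_kernel s \<Omega> a v\<bar> \<le> K * \<bar>v\<bar> powr (- (s + 2))" if v: "v \<noteq> 0" for v
  proof (cases "v \<in> {- R..R}")
    case True
    then have vS: "\<bar>v\<bar> \<le> S" using S by auto
    define P where "P = \<bar>v\<bar> powr (- s)"
    have "1 / S = S powr (- 1)" using S by (simp add: powr_minus inverse_eq_divide)
    also have "\<dots> \<le> S powr (- s)" using S s by (intro powr_mono) auto
    also have "\<dots> \<le> P" unfolding P_def using vS v s by (intro powr_mono2') auto
    finally have P: "1 \<le> S * P" using S by (simp add: field_simps)
    have P0: "P \<ge> 0" by (simp add: P_def)
    have "\<bar>line_kernel s \<Omega> a v\<bar> \<le> M * P + (a\<^sup>2 + v\<^sup>2)"
      unfolding P_def by (rule line_kernel_bound[OF s(1) M v])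
    also have "v\<^sup>2 \<le> S\<^sup>2" using vS S by (simp add: abs_le_square_iff[symmetric])
    also have "M * P + (a\<^sup>2 + S\<^sup>2) \<le> M * P + (a\<^sup>2 + S\<^sup>2) * (S * P)"
      using P mult_left_mono[of 1 "S * P" "a\<^sup>2 + S\<^sup>2"] by simp
    also have "\<dots> = (M + (a\<^sup>2 + S\<^sup>2) * S) * P" by (simp add: algebra_simps)
    finally have 1: "\<bar>line_kernel s \<Omega> a v\<bar> \<le> (M + (a\<^sup>2 + S\<^sup>2) * S) * P" by simp
    have "(M + (a\<^sup>2 + S\<^sup>2) * S) * P * 1 \<le> (M + (a\<^sup>2 + S\<^sup>2) * S) * P * S\<^sup>2"
      using K1 P0 S by (intro mult_left_mono) (auto simp: one_le_power)
    with 1 have 2: "\<bar>line_kernel s \<Omega> a v\<bar> \<le> K * P" by (simp add: K_def mult_ac)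
    have "P \<le> S\<^sup>2 * \<bar>v\<bar> powr (- (s + 2))"
    proof -
      have "\<bar>v\<bar> powr (- (s + 2)) = P * \<bar>v\<bar> powr (- 2)" by (simp add: P_def flip: powr_add)
      also have "\<bar>v\<bar> powr (- 2) = 1 / v\<^sup>2" using v by (simp add: powr_minus powr_numeral inverse_eq_divide)
      finally have e: "S\<^sup>2 * \<bar>v\<bar> powr (- (s + 2)) = P * (S\<^sup>2 / v\<^sup>2)" by simp
      have "1 \<le> S\<^sup>2 / v\<^sup>2" using vS S v by (simp add: abs_le_square_iff[symmetric])
      from mult_left_mono[OF this P0] show ?thesis unfolding e by simp
    qed
    then have "(M + (a\<^sup>2 + S\<^sup>2) * S) * P \<le> (M + (a\<^sup>2 + S\<^sup>2) * S) * (S\<^sup>2 * \<bar>v\<bar> powr (- (s + 2)))"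
      using K1 by (rule mult_left_mono)
    with 1 have 3: "\<bar>line_kernel s \<Omega> a v\<bar> \<le> K * \<bar>v\<bar> powr (- (s + 2))" by (simp add: K_def mult_ac)
    show ?thesis using 2 3 True by (simp add: P_def)
  next
    case False
    then show ?thesis using K1 by (simp add: K_def)
  qed
  show ?thesis
    by (rule integrable_between_powers[of _ s "s + 2" K]) (use * s in auto)
qed

section \<open>The potential of the line and its asymptotics\<close>

text \<open>
  Only the values of \<open>k\<close> on a bounded interval enter, since \<open>\<psi>\<close> has bounded support.
\<close>

lemma convolution_integrable:
  fixes \<psi> k :: "real \<Rightarrow> real"
  assumes [measurable]: "\<psi> \<in> borel_measurable borel" "k \<in> borel_measurable borel"
    and B: "\<And>t. \<bar>\<psi> t\<bar> \<le> B" and R: "\<And>t. R < \<bar>t\<bar> \<Longrightarrow> \<psi> t = 0"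
    and loc: "\<And>r. integrable lborel (\<lambda>v. indicator {- r..r} v * k v)"
  shows "integrable lborel (\<lambda>v. \<psi> (b - v) * k v)"
    and "integrable lborel (\<lambda>t. \<psi> t * k (b - t))"
    and "(LINT t|lborel. \<psi> t * k (b - t)) = (LINT v|lborel. \<psi> (b - v) * k v)"
proof -
  have w: "integrable lborel (\<lambda>v. B * \<bar>indicator {- (R + \<bar>b\<bar>)..R + \<bar>b\<bar>} v * k v\<bar>)"
    by (intro integrable_mult_right integrable_abs loc)
  show 1: "integrable lborel (\<lambda>v. \<psi> (b - v) * k v)"
  proof (rule Bochner_Integration.integrable_bound[OF w])
    have "\<bar>\<psi> (b - v) * k v\<bar> \<le> B * \<bar>indicator {- (R + \<bar>b\<bar>)..R + \<bar>b\<bar>} v * k v\<bar>" for v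
    proof (cases "R < \<bar>b - v\<bar>")
      case True
      have "B \<ge> 0" using B[of 0] by linarith
      then show ?thesis using R[OF True] by simp
    next
      case False
      then have "v \<in> {- (R + \<bar>b\<bar>)..R + \<bar>b\<bar>}" by auto
      then show ?thesis using B[of "b - v"] by (simp add: abs_mult mult_right_mono)
    qed
    then show "AE v in lborel. norm (\<psi> (b - v) * k v) \<le> norm (B * \<bar>indicator {- (R + \<bar>b\<bar>)..R + \<bar>b\<bar>} v * k v\<bar>)"
      by (intro AE_I2) (metis abs_ge_self order_trans real_norm_def)
  qed simp
  show "integrable lborel (\<lambda>t. \<psi> t * k (b - t))"
    using lborel_integrable_real_affine[OF 1, of "- 1" b] by simp
  show "(LINT t|lborel. \<psi> t * k (b - t)) = (LINT v|lborel. \<psi> (b - v) * k v)"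
    using lborel_integral_real_affine[of "- 1" "\<lambda>v. \<psi> (b - v) * k v" b] by simp
qed

text \<open>
  Dominated convergence after moving the translation from the singular kernel to the continuous
  density; the supports of the translated densities stay in a fixed bounded interval.
\<close>

lemma convolution_continuous:
  fixes \<psi> k :: "real \<Rightarrow> real"
  assumes cont: "continuous_on UNIV \<psi>" and [measurable]: "k \<in> borel_measurable borel"
    and B: "\<And>t. \<bar>\<psi> t\<bar> \<le> B" and R: "\<And>t. R < \<bar>t\<bar> \<Longrightarrow> \<psi> t = 0"
    and loc: "\<And>r. integrable lborel (\<lambda>v. indicator {- r..r} v * k v)"
  shows "isCont (\<lambda>b. LINT t|lborel. \<psi> t * k (b - t)) b"
proof -
  have m [measurable]: "\<psi> \<in> borel_measurable borel"
    using cont by (rule borel_measurable_continuous_onI)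
  note eq = convolution_integrable(3)[OF m assms(2) B R loc]
  have B0: "B \<ge> 0" using B[of 0] by linarith
  have "isCont (\<lambda>b. LINT v|lborel. \<psi> (b - v) * k v) b"
    unfolding continuous_at_sequentially comp_def
  proof (intro allI impI)
    fix X :: "nat \<Rightarrow> real" assume X: "X \<longlonglongrightarrow> b"
    then have "Bseq X" by (intro convergent_imp_Bseq convergentI)
    then obtain Z where Z: "\<And>n. \<bar>X n\<bar> \<le> Z" by (auto simp: Bseq_def)
    define r where "r = R + Z"
    show "(\<lambda>n. LINT v|lborel. \<psi> (X n - v) * k v) \<longlonglongrightarrow> (LINT v|lborel. \<psi> (b - v) * k v)"
    proof (rule integral_dominated_convergence)
      show "integrable lborel (\<lambda>v. B * \<bar>indicator {- r..r} v * k v\<bar>)"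
        by (intro integrable_mult_right integrable_abs loc)
      show "AE v in lborel. (\<lambda>n. \<psi> (X n - v) * k v) \<longlonglongrightarrow> \<psi> (b - v) * k v"
      proof (intro AE_I2 tendsto_mult tendsto_const)
        fix v
        have "isCont \<psi> (b - v)" using cont by (simp add: continuous_on_eq_continuous_at)
        then show "(\<lambda>n. \<psi> (X n - v)) \<longlonglongrightarrow> \<psi> (b - v)"
          by (rule isCont_tendsto_compose) (intro tendsto_intros X)
      qed
      show "AE v in lborel. norm (\<psi> (X n - v) * k v) \<le> B * \<bar>indicator {- r..r} v * k v\<bar>" for n
      proof (intro AE_I2)
        fix v
        show "norm (\<psi> (X n - v) * k v) \<le> B * \<bar>indicator {- r..r} v * k v\<bar>"
        proof (cases "R < \<bar>X n - v\<bar>")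
          case True
          then show ?thesis using R[OF True] B0 by simp
        next
          case False
          then have "v \<in> {- r..r}" using Z[of n] by (auto simp: r_def)
          then show ?thesis using B[of "X n - v"] by (simp add: abs_mult mult_right_mono)
        qed
      qed
    qed simp_all
  qed
  then show ?thesis by (simp add: eq)
qed

locale vertical_line =
  fixes s :: real and \<Omega> \<psi> :: "real \<Rightarrow> real"
  assumes s: "0 < s" "s < 1"
    and \<Omega>_cont: "continuous_on UNIV \<Omega>"
    and \<Omega>_pos: "\<And>\<theta>. \<Omega> \<theta> > 0"
    and \<Omega>_periodic: "\<And>\<theta>. \<Omega> (\<theta> + pi) = \<Omega> \<theta>"
    and \<psi>_nonneg: "\<And>t. \<psi> t \<ge> 0"
    and \<psi>_cont: "continuous_on UNIV \<psi>"
    and \<psi>_supp: "compact (closure {t. \<psi> t \<noteq> 0})"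
    and \<psi>_mass: "(LINT t|lborel. \<psi> t) = 1"
begin

abbreviation kernel :: "real \<Rightarrow> real \<Rightarrow> real" where
  "kernel \<equiv> line_kernel s \<Omega>"

abbreviation profile :: "real \<Rightarrow> real" where
  "profile \<equiv> line_profile s \<Omega>"

definition potential :: "real \<Rightarrow> real \<Rightarrow> real" where
  "potential a b = (LINT t|lborel. \<psi> t * kernel a (b - t))"

lemma measurable_data [measurable]: "\<Omega> \<in> borel_measurable borel" "\<psi> \<in> borel_measurable borel"
  using \<Omega>_cont \<psi>_cont by (auto intro: borel_measurable_continuous_onI)

lemma measurable_profile [measurable]: "profile \<in> borel_measurable borel"
proof -
  have [measurable]: "(arctan :: real \<Rightarrow> real) \<in> borel_measurable borel"
    by (intro borel_measurable_continuous_onI continuous_intros)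
  have "(\<lambda>u. line_profile s \<Omega> u) \<in> borel_measurable borel" unfolding line_profile_def by measurable
  then show ?thesis .
qed

lemma \<psi>_vanishes: obtains R where "\<And>t. R < \<bar>t\<bar> \<Longrightarrow> \<psi> t = 0"
proof -
  have "bounded {t. \<psi> t \<noteq> 0}" using \<psi>_supp by (rule bounded_subset[OF compact_imp_bounded closure_subset])
  then obtain R where "\<And>t. \<psi> t \<noteq> 0 \<Longrightarrow> \<bar>t\<bar> \<le> R" by (auto simp: bounded_iff)
  then show thesis using that by (metis not_le)
qed

lemma \<psi>_bounded: obtains B where "B > 0" "\<And>t. \<bar>\<psi> t\<bar> \<le> B"
proof -
  obtain R where R: "\<And>t. R < \<bar>t\<bar> \<Longrightarrow> \<psi> t = 0" using \<psi>_vanishes by blast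
  have "compact (\<psi> ` {- R..R})"
    by (intro compact_continuous_image continuous_on_subset[OF \<psi>_cont]) auto
  then have "bounded (\<psi> ` {- R..R})" by (rule compact_imp_bounded)
  then obtain B where B: "\<And>t. t \<in> {- R..R} \<Longrightarrow> \<bar>\<psi> t\<bar> \<le> B"
    unfolding bounded_iff real_norm_def by blast
  have "\<bar>\<psi> t\<bar> \<le> max B 1" for t
  proof (cases "t \<in> {- R..R}")
    case True
    then show ?thesis using B[of t] by simp
  next
    case False
    then have "R < \<bar>t\<bar>" by auto
    then show ?thesis using R[of t] by simp
  qed
  then show thesis using that[of "max B 1"] by simp
qed

lemma \<Omega>_bounded: obtains M where "\<And>\<theta>. \<bar>\<Omega> \<theta>\<bar> \<le> M"
  using pi_periodic_bounded[of \<Omega>, OF \<Omega>_periodic \<Omega>_cont] by blast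

lemma kernel_nonneg: "kernel a v \<ge> 0"
  unfolding line_kernel_def using \<Omega>_pos by (intro add_nonneg_nonneg mult_nonneg_nonneg) (auto intro: less_imp_le)

lemma kernel_locally_integrable: "integrable lborel (\<lambda>v. indicator {- r..r} v * kernel a v)"
proof -
  obtain M where M: "\<And>\<theta>. \<bar>\<Omega> \<theta>\<bar> \<le> M" using \<Omega>_bounded by blast
  show ?thesis by (rule line_kernel_locally_integrable[OF s M]) simp
qed

lemma kernel_measurable1 [measurable]: "kernel a \<in> borel_measurable borel"
proof -
  have "(\<lambda>v. kernel a v) \<in> borel_measurable borel" by measurable
  then show ?thesis .
qed

lemma potential_integrable:
  "integrable lborel (\<lambda>v. \<psi> (b - v) * kernel a v)"
  "integrable lborel (\<lambda>t. \<psi> t * kernel a (b - t))"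
  "potential a b = (LINT v|lborel. \<psi> (b - v) * kernel a v)"
proof -
  obtain R where R: "\<And>t. R < \<bar>t\<bar> \<Longrightarrow> \<psi> t = 0" using \<psi>_vanishes by blast
  obtain B where B: "\<And>t. \<bar>\<psi> t\<bar> \<le> B" using \<psi>_bounded by blast
  note c = convolution_integrable[OF measurable_data(2) kernel_measurable1 B R kernel_locally_integrable]
  show "integrable lborel (\<lambda>v. \<psi> (b - v) * kernel a v)" by (rule c(1))
  show "integrable lborel (\<lambda>t. \<psi> t * kernel a (b - t))" by (rule c(2))
  show "potential a b = (LINT v|lborel. \<psi> (b - v) * kernel a v)"
    unfolding potential_def by (rule c(3))
qed

lemma potential_isCont: "isCont (potential a) b"
proof -
  obtain R where R: "\<And>t. R < \<bar>t\<bar> \<Longrightarrow> \<psi> t = 0" using \<psi>_vanishes by blast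
  obtain B where B: "\<And>t. \<bar>\<psi> t\<bar> \<le> B" using \<psi>_bounded by blast
  have "isCont (\<lambda>b. LINT t|lborel. \<psi> t * kernel a (b - t)) b"
    by (rule convolution_continuous[OF \<psi>_cont kernel_measurable1 B R kernel_locally_integrable])
  moreover have "potential a = (\<lambda>b. LINT t|lborel. \<psi> t * kernel a (b - t))"
    by (simp add: potential_def fun_eq_iff)
  ultimately show ?thesis by simp
qed

lemma potential_nonneg: "potential a b \<ge> 0"
  unfolding potential_def using \<psi>_nonneg kernel_nonneg by (intro Bochner_Integration.integral_nonneg) auto

lemma \<psi>_integrable: "integrable lborel \<psi>"
  using \<psi>_mass not_integrable_integral_eq[of lborel \<psi>] by auto

lemma \<psi>_reflected_integral: "integrable lborel (\<lambda>v. \<psi> (- v))" "(LINT v|lborel. \<psi> (- v)) = 1"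
  using lborel_integrable_real_affine[OF \<psi>_integrable, of "- 1" 0] \<psi>_mass
    lborel_integral_real_affine[of "- 1" \<psi> 0] by auto

lemma profile_power_bound:
  assumes p: "p = 1 \<or> p = 2"
    and ev: "\<forall>\<^sub>F \<theta> in nhds (pi / 2). \<bar>\<Omega> \<theta> - \<Omega> (pi / 2)\<bar> \<le> K * \<bar>\<theta> - pi / 2\<bar> ^ p"
  obtains H where "H \<ge> 0" "\<And>u. u \<noteq> 0 \<Longrightarrow> \<bar>profile u\<bar> \<le> H * \<bar>u\<bar> powr (- s)"
    "\<And>u. u \<noteq> 0 \<Longrightarrow> \<bar>profile u\<bar> \<le> H * \<bar>u\<bar> powr (- (s + real p))"
proof -
  obtain M where M: "\<And>\<theta>. \<bar>\<Omega> \<theta>\<bar> \<le> M" using \<Omega>_bounded by blast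
  obtain C where C: "C \<ge> 0" "\<And>\<theta>. \<bar>\<Omega> \<theta> - \<Omega> (pi / 2)\<bar> \<le> C * \<bar>\<theta> - pi / 2\<bar> ^ p"
    using local_power_bound_global[OF M ev] by blast
  show thesis using line_profile_bound[OF s p, of \<Omega>, OF \<Omega>_periodic M C] that by blast
qed

lemma rescaled_integral:
  fixes g :: "real \<Rightarrow> real"
  assumes "\<epsilon> > 0" "integrable lborel g"
  shows "integrable lborel (\<lambda>v. g (v / \<epsilon>))" "(LINT v|lborel. g (v / \<epsilon>)) = \<epsilon> * (LINT u|lborel. g u)"
  using assms lborel_integrable_real_affine[OF assms(2), of "1 / \<epsilon>" 0]
    lborel_integral_real_affine[of "1 / \<epsilon>" g 0] by (auto simp: field_simps)

text \<open>
  The exact form of the asymptotic formula: after replacing \<open>\<psi> (-v)\<close> by \<open>\<psi> 0\<close> the integral of the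
  rescaled profile is the main term, and the error is an explicit integral.
\<close>

lemma potential_expansion:
  assumes \<epsilon>: "\<epsilon> > 0" and h: "integrable lborel profile"
  shows "potential \<epsilon> 0 - potential 0 0 - 1 / (2 * tau (2 - s)) * Omega_tilde s \<Omega> 0 * \<psi> 0 * \<epsilon> powr (1 - s)
      = \<epsilon>\<^sup>2 + (LINT v|lborel. (\<psi> (- v) - \<psi> 0) * (\<epsilon> powr (- s) * profile (v / \<epsilon>)))"
    and "integrable lborel (\<lambda>v. (\<psi> (- v) - \<psi> 0) * (\<epsilon> powr (- s) * profile (v / \<epsilon>)))"
proof -
  define g where "g = (\<lambda>v. \<epsilon> powr (- s) * profile (v / \<epsilon>))"
  have g: "integrable lborel g" unfolding g_def
    by (intro integrable_mult_right rescaled_integral(1)[OF \<epsilon> h])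
  have "(LINT v|lborel. g v) = \<epsilon> powr (- s) * (\<epsilon> * (1 / (2 * tau (2 - s)) * Omega_tilde s \<Omega> 0))"
    unfolding g_def using rescaled_integral[OF \<epsilon> h]
      integral_line_profile[of s \<Omega>, OF s \<Omega>_cont \<Omega>_periodic h] by simp
  also have "\<dots> = \<epsilon> powr (1 - s) * (1 / (2 * tau (2 - s)) * Omega_tilde s \<Omega> 0)"
    using \<epsilon> by (simp add: powr_diff powr_minus field_simps)
  finally have gi: "(LINT v|lborel. g v) = \<epsilon> powr (1 - s) * (1 / (2 * tau (2 - s)) * Omega_tilde s \<Omega> 0)" .
  have gv: "g v = \<epsilon> powr (- s) * profile (v / \<epsilon>)" for v by (simp add: g_def)
  note P = potential_integrable[where b = 0, simplified]
  have pw: "\<psi> (- v) * g v = \<psi> (- v) * kernel \<epsilon> v - \<psi> (- v) * kernel 0 v - \<epsilon>\<^sup>2 * \<psi> (- v)" for v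
  proof -
    have "g v = kernel \<epsilon> v - kernel 0 v - \<epsilon>\<^sup>2"
      using line_kernel_rescale[OF \<epsilon>, of s \<Omega> v] by (simp add: g_def)
    then show ?thesis by (simp only: right_diff_distrib mult.commute)
  qed
  have pg: "integrable lborel (\<lambda>v. \<psi> (- v) * g v)"
    unfolding pw by (intro Bochner_Integration.integrable_diff integrable_mult_right P \<psi>_reflected_integral)
  have "(LINT v|lborel. \<psi> (- v) * g v) = potential \<epsilon> 0 - potential 0 0 - \<epsilon>\<^sup>2"
    unfolding pw P(3) using P(1) \<psi>_reflected_integral by simp
  moreover have "(LINT v|lborel. (\<psi> (- v) - \<psi> 0) * g v) = (LINT v|lborel. \<psi> (- v) * g v) - \<psi> 0 * (LINT v|lborel. g v)"
    unfolding left_diff_distrib using pg g by simp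
  ultimately show "potential \<epsilon> 0 - potential 0 0 - 1 / (2 * tau (2 - s)) * Omega_tilde s \<Omega> 0 * \<psi> 0 * \<epsilon> powr (1 - s)
      = \<epsilon>\<^sup>2 + (LINT v|lborel. (\<psi> (- v) - \<psi> 0) * (\<epsilon> powr (- s) * profile (v / \<epsilon>)))"
    unfolding gi gv[symmetric] by (simp add: mult_ac)
  show "integrable lborel (\<lambda>v. (\<psi> (- v) - \<psi> 0) * (\<epsilon> powr (- s) * profile (v / \<epsilon>)))"
    using pg g unfolding gv[symmetric] left_diff_distrib by simp
qed

lemma profile_integrable:
  assumes "\<And>u. u \<noteq> 0 \<Longrightarrow> \<bar>profile u\<bar> \<le> H * \<bar>u\<bar> powr (- s)"
    "\<And>u. u \<noteq> 0 \<Longrightarrow> \<bar>profile u\<bar> \<le> H * \<bar>u\<bar> powr (- (s + real p))" and p: "p \<ge> 1"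
  shows "integrable lborel profile"
  by (rule integrable_between_powers[of _ s "s + real p" H]) (use assms s in auto)

definition remainder :: "real \<Rightarrow> real" where
  "remainder \<epsilon> = potential \<epsilon> 0 - potential 0 0
     - 1 / (2 * tau (2 - s)) * Omega_tilde s \<Omega> 0 * \<psi> 0 * \<epsilon> powr (1 - s)"

text \<open>
  Scaling the bound \<open>H * \<bar>u\<bar> powr (-s-1)\<close> produces exactly one factor \<open>\<epsilon>\<close> and a weight independent
  of \<open>\<epsilon>\<close>. Its singularity at \<open>0\<close> is compensated by \<open>\<psi> (-v) - \<psi> 0 = O(\<bar>v\<bar>)\<close>.
\<close>

lemma remainder_linear:
  assumes D: "(\<Omega> has_real_derivative D) (at (pi / 2))" and D': "(\<psi> has_real_derivative D') (at 0)"
  shows "remainder \<in> O[at_right 0](\<lambda>\<epsilon>. \<epsilon>)"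
proof -
  obtain H where H: "H \<ge> 0" "\<And>u. u \<noteq> 0 \<Longrightarrow> \<bar>profile u\<bar> \<le> H * \<bar>u\<bar> powr (- s)"
    "\<And>u. u \<noteq> 0 \<Longrightarrow> \<bar>profile u\<bar> \<le> H * \<bar>u\<bar> powr (- (s + real 1))"
    by (rule profile_power_bound[OF _ differentiable_eventually_linear_bound[OF D]]) auto
  have h: "integrable lborel profile" by (rule profile_integrable[OF H(2,3)]) auto
  obtain B where B: "B > 0" "\<And>t. \<bar>\<psi> t\<bar> \<le> B" using \<psi>_bounded by blast
  obtain L where L: "L \<ge> 0" "\<And>t. \<bar>\<psi> t - \<psi> 0\<bar> \<le> L * \<bar>t - 0\<bar> ^ 1"
    using local_power_bound_global[OF B(2) differentiable_eventually_linear_bound[OF D']] by blast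
  define w where "w = (\<lambda>v. \<bar>\<psi> (- v) - \<psi> 0\<bar> * (H * \<bar>v\<bar> powr (- s - 1)))"
  have w: "integrable lborel w"
  proof (rule integrable_between_powers[of w s "s + 1" "(L + 2 * B) * H"])
    fix v :: real assume v: "v \<noteq> 0"
    have e: "\<bar>v\<bar> * \<bar>v\<bar> powr (- s - 1) = \<bar>v\<bar> powr (- s)" using v by (simp add: powr_diff)
    have "w v \<le> (L * \<bar>v\<bar>) * (H * \<bar>v\<bar> powr (- s - 1))"
      unfolding w_def using L(2)[of "- v"] H(1) by (intro mult_right_mono) auto
    also have "\<dots> = (L * H) * \<bar>v\<bar> powr (- s)" unfolding e[symmetric] by simp
    also have "\<dots> \<le> ((L + 2 * B) * H) * \<bar>v\<bar> powr (- s)"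
      using B H(1) by (intro mult_right_mono) auto
    finally show "\<bar>w v\<bar> \<le> ((L + 2 * B) * H) * \<bar>v\<bar> powr (- s)" using H(1) by (simp add: w_def)
    have "\<bar>\<psi> (- v) - \<psi> 0\<bar> \<le> 2 * B" using B(2)[of "- v"] B(2)[of 0] by linarith
    also have "\<dots> \<le> L + 2 * B" using L by simp
    finally have "w v \<le> (L + 2 * B) * (H * \<bar>v\<bar> powr (- s - 1))"
      unfolding w_def using H(1) by (intro mult_right_mono) auto
    then show "\<bar>w v\<bar> \<le> ((L + 2 * B) * H) * \<bar>v\<bar> powr (- (s + 1))" using H(1) by (simp add: w_def)
  qed (use s in \<open>auto simp: w_def\<close>)
  have bound: "\<bar>remainder \<epsilon>\<bar> \<le> \<epsilon>\<^sup>2 + \<epsilon> * (LINT v|lborel. w v)" if \<epsilon>: "\<epsilon> > 0" for \<epsilon>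
  proof -
    note ex = potential_expansion[OF \<epsilon> h]
    let ?I = "\<lambda>v. (\<psi> (- v) - \<psi> 0) * (\<epsilon> powr (- s) * profile (v / \<epsilon>))"
    have pt: "\<bar>?I v\<bar> \<le> \<epsilon> * w v" for v
    proof (cases "v = 0")
      case False
      have "\<epsilon> powr (- s) * \<bar>profile (v / \<epsilon>)\<bar> \<le> \<epsilon> powr (- s) * (H * \<bar>v / \<epsilon>\<bar> powr (- (s + real 1)))"
        using False \<epsilon> by (intro mult_left_mono H(3)) auto
      also have "\<bar>v / \<epsilon>\<bar> powr (- (s + real 1)) = \<bar>v\<bar> powr (- s - 1) / \<epsilon> powr (- s - 1)"
        using \<epsilon> by (simp add: abs_divide powr_divide)
      also have "\<epsilon> powr (- s) * (H * (\<bar>v\<bar> powr (- s - 1) / \<epsilon> powr (- s - 1))) = \<epsilon> * (H * \<bar>v\<bar> powr (- s - 1))"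
        using \<epsilon> by (simp add: powr_diff)
      finally have "\<bar>\<psi> (- v) - \<psi> 0\<bar> * (\<epsilon> powr (- s) * \<bar>profile (v / \<epsilon>)\<bar>)
          \<le> \<bar>\<psi> (- v) - \<psi> 0\<bar> * (\<epsilon> * (H * \<bar>v\<bar> powr (- s - 1)))"
        by (rule mult_left_mono) simp
      then show ?thesis by (simp add: w_def abs_mult mult_ac)
    qed (simp add: w_def)
    have "\<bar>LINT v|lborel. ?I v\<bar> \<le> (LINT v|lborel. \<bar>?I v\<bar>)" by (rule integral_abs_bound)
    also have "\<dots> \<le> (LINT v|lborel. \<epsilon> * w v)"
      using ex(2) w pt by (intro integral_mono) auto
    also have "\<dots> = \<epsilon> * (LINT v|lborel. w v)" by simp
    finally show ?thesis
      using abs_triangle_ineq[of "\<epsilon>\<^sup>2" "LINT v|lborel. ?I v"] abs_of_nonneg[OF zero_le_power2[of \<epsilon>]]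
      unfolding remainder_def ex(1) by linarith
  qed
  show ?thesis
  proof (rule bigoI[where c = "1 + (LINT v|lborel. w v)"])
    show "\<forall>\<^sub>F \<epsilon> in at_right 0. norm (remainder \<epsilon>) \<le> (1 + (LINT v|lborel. w v)) * norm \<epsilon>"
      using eventually_at_right_real[OF zero_less_one]
    proof eventually_elim
      case (elim \<epsilon>)
      have "\<epsilon>\<^sup>2 \<le> \<epsilon>" using elim by (simp add: power2_eq_square mult_left_le)
      then show ?case using bound[of \<epsilon>] elim by (simp add: algebra_simps)
    qed
  qed
qed

text \<open>
  With one more power of decay the first moment of the profile converges, so that
  \<open>\<psi> (-v) - \<psi> 0 = O(\<bar>v\<bar>)\<close> contributes a full factor \<open>\<epsilon>\<close> in addition to \<open>\<epsilon> powr (1 - s)\<close>.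
\<close>

lemma remainder_critical:
  assumes D: "\<And>\<theta>. (\<Omega> has_real_derivative \<Omega>' \<theta>) (at \<theta>)" and D2: "(\<Omega>' has_real_derivative D) (at (pi / 2))"
    and crit: "\<Omega>' (pi / 2) = 0" and D': "(\<psi> has_real_derivative D') (at 0)"
  shows "remainder \<in> O[at_right 0](\<lambda>\<epsilon>. \<epsilon> powr (2 - s))"
proof -
  obtain H where H: "H \<ge> 0" "\<And>u. u \<noteq> 0 \<Longrightarrow> \<bar>profile u\<bar> \<le> H * \<bar>u\<bar> powr (- s)"
    "\<And>u. u \<noteq> 0 \<Longrightarrow> \<bar>profile u\<bar> \<le> H * \<bar>u\<bar> powr (- (s + real 2))"
    by (rule profile_power_bound[OF _ critical_eventually_quadratic_bound[OF D D2 crit]]) auto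
  have h: "integrable lborel profile" by (rule profile_integrable[OF H(2,3)]) auto
  obtain B where B: "B > 0" "\<And>t. \<bar>\<psi> t\<bar> \<le> B" using \<psi>_bounded by blast
  obtain L where L: "L \<ge> 0" "\<And>t. \<bar>\<psi> t - \<psi> 0\<bar> \<le> L * \<bar>t - 0\<bar> ^ 1"
    using local_power_bound_global[OF B(2) differentiable_eventually_linear_bound[OF D']] by blast
  define w where "w = (\<lambda>u. L * (\<bar>u\<bar> * \<bar>profile u\<bar>))"
  have w: "integrable lborel w"
  proof (rule integrable_between_powers[of w "s - 1" "s + 1" "L * H"])
    fix u :: real assume u: "u \<noteq> 0"
    have e: "\<bar>u\<bar> * \<bar>u\<bar> powr r = \<bar>u\<bar> powr (r + 1)" for r using u by (simp add: powr_add)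
    have "w u \<le> L * (\<bar>u\<bar> * (H * \<bar>u\<bar> powr (- s)))" "w u \<le> L * (\<bar>u\<bar> * (H * \<bar>u\<bar> powr (- (s + real 2))))"
      unfolding w_def using H(2)[OF u] H(3)[OF u] L(1) by (auto intro!: mult_left_mono)
    moreover have "L * (\<bar>u\<bar> * (H * \<bar>u\<bar> powr (- s))) = L * H * \<bar>u\<bar> powr (- (s - 1))"
      using e[of "- s"] by (simp add: mult_ac)
    moreover have "L * (\<bar>u\<bar> * (H * \<bar>u\<bar> powr (- (s + real 2)))) = L * H * \<bar>u\<bar> powr (- (s + 1))"
    proof -
      have "\<bar>u\<bar> * \<bar>u\<bar> powr (- (s + real 2)) = \<bar>u\<bar> powr (1 + - (s + real 2))"
        using u by (intro powr_mult_base) auto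
      also have "1 + - (s + real 2) = - (s + 1)" by simp
      finally show ?thesis by (metis mult.assoc mult.left_commute)
    qed
    ultimately have "w u \<le> L * H * \<bar>u\<bar> powr (- (s - 1))" "w u \<le> L * H * \<bar>u\<bar> powr (- (s + 1))"
      by linarith+
    moreover have "\<bar>w u\<bar> = w u" using L(1) by (simp add: w_def)
    ultimately show "\<bar>w u\<bar> \<le> L * H * \<bar>u\<bar> powr (- (s - 1))" "\<bar>w u\<bar> \<le> L * H * \<bar>u\<bar> powr (- (s + 1))"
      by simp_all
  qed (use s in \<open>auto simp: w_def\<close>)
  have bound: "\<bar>remainder \<epsilon>\<bar> \<le> \<epsilon>\<^sup>2 + \<epsilon> powr (2 - s) * (LINT u|lborel. w u)" if \<epsilon>: "\<epsilon> > 0" for \<epsilon>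
  proof -
    note ex = potential_expansion[OF \<epsilon> h]
    let ?I = "\<lambda>v. (\<psi> (- v) - \<psi> 0) * (\<epsilon> powr (- s) * profile (v / \<epsilon>))"
    have pt: "\<bar>?I v\<bar> \<le> \<epsilon> powr (1 - s) * w (v / \<epsilon>)" for v
    proof -
      have "\<bar>?I v\<bar> \<le> (L * \<bar>v\<bar>) * (\<epsilon> powr (- s) * \<bar>profile (v / \<epsilon>)\<bar>)"
        unfolding abs_mult using L(2)[of "- v"] by (intro mult_mono) auto
      also have "\<bar>v\<bar> = \<epsilon> * \<bar>v / \<epsilon>\<bar>" using \<epsilon> by (simp add: abs_divide)
      also have "L * (\<epsilon> * \<bar>v / \<epsilon>\<bar>) * (\<epsilon> powr (- s) * \<bar>profile (v / \<epsilon>)\<bar>) = (\<epsilon> * \<epsilon> powr (- s)) * w (v / \<epsilon>)"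
        by (simp add: w_def mult_ac)
      also have "\<epsilon> * \<epsilon> powr (- s) = \<epsilon> powr (1 - s)" using \<epsilon> by (simp add: powr_diff powr_minus field_simps)
      finally show ?thesis .
    qed
    have ws: "integrable lborel (\<lambda>v. w (v / \<epsilon>))" "(LINT v|lborel. w (v / \<epsilon>)) = \<epsilon> * (LINT u|lborel. w u)"
      by (rule rescaled_integral[OF \<epsilon> w])+
    have "\<bar>LINT v|lborel. ?I v\<bar> \<le> (LINT v|lborel. \<bar>?I v\<bar>)" by (rule integral_abs_bound)
    also have "\<dots> \<le> (LINT v|lborel. \<epsilon> powr (1 - s) * w (v / \<epsilon>))"
      using ex(2) ws pt by (intro integral_mono) auto
    also have "\<dots> = (\<epsilon> powr (1 - s) * \<epsilon>) * (LINT u|lborel. w u)" using ws by simp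
    also have "\<epsilon> powr (1 - s) * \<epsilon> = \<epsilon> powr (2 - s)"
    proof -
      have "\<epsilon> powr (1 - s + 1) = \<epsilon> powr (1 - s) * \<epsilon> powr 1" by (rule powr_add)
      then show ?thesis using \<epsilon> by simp
    qed
    finally show ?thesis
      using abs_triangle_ineq[of "\<epsilon>\<^sup>2" "LINT v|lborel. ?I v"] abs_of_nonneg[OF zero_le_power2[of \<epsilon>]]
      unfolding remainder_def ex(1) by linarith
  qed
  show ?thesis
  proof (rule bigoI[where c = "1 + (LINT u|lborel. w u)"])
    show "\<forall>\<^sub>F \<epsilon> in at_right 0. norm (remainder \<epsilon>) \<le> (1 + (LINT u|lborel. w u)) * norm (\<epsilon> powr (2 - s))"
      using eventually_at_right_real[OF zero_less_one]
    proof eventually_elim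
      case (elim \<epsilon>)
      have "\<epsilon>\<^sup>2 = \<epsilon> powr 2" using elim by (simp add: powr_numeral)
      also have "\<dots> \<le> \<epsilon> powr (2 - s)" using elim s by (intro powr_mono') auto
      finally show ?case using bound[of \<epsilon>] elim by (simp add: algebra_simps)
    qed
  qed
qed

lemma measure_line: "prob_space (density lborel (\<lambda>t. ennreal (\<psi> t)))"
proof (rule prob_spaceI)
  have "emeasure (density lborel (\<lambda>t. ennreal (\<psi> t))) (space (density lborel (\<lambda>t. ennreal (\<psi> t))))
      = (\<integral>\<^sup>+t. ennreal (\<psi> t) \<partial>lborel)" by (simp add: emeasure_density)
  also have "\<dots> = ennreal (LINT t|lborel. \<psi> t)"
    using \<psi>_nonneg by (intro nn_integral_eq_integral \<psi>_integrable) auto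
  finally show "emeasure (density lborel (\<lambda>t. ennreal (\<psi> t))) (space (density lborel (\<lambda>t. ennreal (\<psi> t)))) = 1"
    using \<psi>_mass by simp
qed

lemma measurable_interaction [measurable]: "interaction s \<Omega> \<in> borel_measurable borel"
proof -
  have "interaction s \<Omega> = (\<lambda>x. if fst x = 0 \<and> snd x = 0 then \<infinity> else ennreal (kernel (fst x) (snd x)))"
    using interaction_line_kernel[of \<Omega> s, OF \<Omega>_periodic] by (auto simp: fun_eq_iff)
  also have "\<dots> \<in> borel_measurable (borel \<Otimes>\<^sub>M borel)" by measurable
  finally show ?thesis by (simp add: borel_prod)
qed

lemma nn_integral_interaction:
  "(\<integral>\<^sup>+t. interaction s \<Omega> (a, b - t) \<partial>density lborel (\<lambda>t. ennreal (\<psi> t))) = ennreal (potential a b)"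
proof -
  have "(\<integral>\<^sup>+t. interaction s \<Omega> (a, b - t) \<partial>density lborel (\<lambda>t. ennreal (\<psi> t)))
      = (\<integral>\<^sup>+t. ennreal (\<psi> t) * interaction s \<Omega> (a, b - t) \<partial>lborel)"
    by (subst nn_integral_density) (auto simp: borel_prod[symmetric])
  also have "\<dots> = (\<integral>\<^sup>+t. ennreal (\<psi> t * kernel a (b - t)) \<partial>lborel)"
  proof (rule nn_integral_cong_AE)
    show "AE t in lborel. ennreal (\<psi> t) * interaction s \<Omega> (a, b - t) = ennreal (\<psi> t * kernel a (b - t))"
      using AE_lborel_singleton[of b]
      by eventually_elim
        (auto simp: interaction_line_kernel[of \<Omega> s, OF \<Omega>_periodic] ennreal_mult' \<psi>_nonneg kernel_nonneg)
  qed
  also have "\<dots> = ennreal (potential a b)"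
    unfolding potential_def using \<psi>_nonneg kernel_nonneg
    by (intro nn_integral_eq_integral potential_integrable) auto
  finally show ?thesis .
qed

lemma convol_potential: "convol (interaction s \<Omega>) (vertical_measure \<psi>) (a, b) = ennreal (potential a b)"
proof -
  have "convol (interaction s \<Omega>) (vertical_measure \<psi>) (a, b)
      = (\<integral>\<^sup>+t. interaction s \<Omega> (a, b - t) \<partial>density lborel (\<lambda>t. ennreal (\<psi> t)))"
  proof -
    have [measurable]: "(\<lambda>t::real. (0::real, t)) \<in> borel_measurable borel"
      by (intro borel_measurable_continuous_onI continuous_intros)
    have [measurable]: "(\<lambda>y. interaction s \<Omega> ((a, b) - y)) \<in> borel_measurable borel" by measurable
    show ?thesis
      unfolding convol_def vertical_measure_def by (subst nn_integral_distr) auto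
  qed
  then show ?thesis by (simp add: nn_integral_interaction)
qed

end

section \<open>Energy of a line with a displaced segment\<close>

context vertical_line
begin

abbreviation line_measure :: "real measure" where
  "line_measure \<equiv> density lborel (\<lambda>t. ennreal (\<psi> t))"

abbreviation W :: "real \<times> real \<Rightarrow> ennreal" where
  "W \<equiv> interaction s \<Omega>"

definition shifted_line :: "real set \<Rightarrow> real \<Rightarrow> real \<Rightarrow> real \<times> real" where
  "shifted_line A \<epsilon> t = (if t \<in> A then \<epsilon> else 0, t)"

lemma measurable_shifted_line [measurable]:
  assumes [measurable]: "A \<in> sets borel"
  shows "shifted_line A \<epsilon> \<in> borel_measurable borel"
proof -
  have "(\<lambda>t. (if t \<in> A then \<epsilon> else 0, t)) \<in> borel \<rightarrow>\<^sub>M (borel \<Otimes>\<^sub>M borel)" by measurable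
  then show ?thesis by (simp add: shifted_line_def[abs_def] borel_prod)
qed

lemma sigma_finite_line: "sigma_finite_measure line_measure"
  using measure_line by (rule prob_space_imp_sigma_finite)

lemma pair_sigma_finite_line: "pair_sigma_finite line_measure line_measure"
  using sigma_finite_line by (simp add: pair_sigma_finite_def)

lemma energy_distr:
  assumes T [measurable]: "T \<in> borel_measurable borel"
  shows "energy W (distr line_measure borel T)
      = (\<integral>\<^sup>+z. W (T (fst z) - T (snd z)) \<partial>(line_measure \<Otimes>\<^sub>M line_measure)) / 2"
proof -
  interpret sigma_finite_measure line_measure by (rule sigma_finite_line)
  have T': "T \<in> line_measure \<rightarrow>\<^sub>M borel" by simp
  have inner: "convol W (distr line_measure borel T) x = (\<integral>\<^sup>+t. W (x - T t) \<partial>line_measure)" for x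
  proof -
    have [measurable]: "(\<lambda>y. W (x - y)) \<in> borel_measurable borel" by measurable
    show ?thesis unfolding convol_def by (subst nn_integral_distr) auto
  qed
  have m: "(\<lambda>x. \<integral>\<^sup>+t. W (x - T t) \<partial>line_measure) \<in> borel_measurable borel"
    by (rule borel_measurable_nn_integral) measurable
  have "(\<integral>\<^sup>+x. convol W (distr line_measure borel T) x \<partial>distr line_measure borel T)
      = (\<integral>\<^sup>+t'. \<integral>\<^sup>+t. W (T t' - T t) \<partial>line_measure \<partial>line_measure)"
    unfolding inner using m by (subst nn_integral_distr) auto
  also have "\<dots> = (\<integral>\<^sup>+z. W (T (fst z) - T (snd z)) \<partial>(line_measure \<Otimes>\<^sub>M line_measure))"
    by (subst nn_integral_fst[symmetric]) auto
  finally show ?thesis by (simp add: energy_def)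
qed

text \<open>
  The interaction of the part \<open>S\<close> of the line with the part \<open>S'\<close>, summed over ordered pairs, when \<open>S\<close>
  is displaced horizontally by \<open>a\<close> relative to \<open>S'\<close>.
\<close>

definition pair_energy :: "real \<Rightarrow> real set \<Rightarrow> real set \<Rightarrow> ennreal" where
  "pair_energy a S S' =
     (\<integral>\<^sup>+z. indicator (S \<times> S') z * W (a, fst z - snd z) \<partial>(line_measure \<Otimes>\<^sub>M line_measure))"

lemma measurable_pair_interaction [measurable]:
  "(\<lambda>z. W (a, fst z - snd z)) \<in> borel_measurable (line_measure \<Otimes>\<^sub>M line_measure)"
proof -
  have "(\<lambda>z. (a, fst z - snd z)) \<in> line_measure \<Otimes>\<^sub>M line_measure \<rightarrow>\<^sub>M (borel :: (real \<times> real) measure)"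
    unfolding borel_prod[symmetric] by measurable
  then show ?thesis by measurable
qed

lemma measurable_rectangle [measurable]:
  assumes "S \<in> sets borel" "S' \<in> sets borel"
  shows "S \<times> S' \<in> sets (line_measure \<Otimes>\<^sub>M line_measure)"
  using assms by (intro pair_measureI) auto

lemma interaction_minus: "W (- a, - v) = W (a, v)"
  by (simp add: interaction_line_kernel[of \<Omega> s, OF \<Omega>_periodic] line_kernel_minus)

lemma pair_energy_swap:
  assumes [measurable]: "S \<in> sets borel" "S' \<in> sets borel"
  shows "pair_energy (- a) S' S = pair_energy a S S'"
proof -
  interpret pair_sigma_finite line_measure line_measure by (rule pair_sigma_finite_line)
  have "pair_energy (- a) S' S =
      (\<integral>\<^sup>+z. indicator (S' \<times> S) z * W (- a, fst z - snd z)
        \<partial>distr (line_measure \<Otimes>\<^sub>M line_measure) (line_measure \<Otimes>\<^sub>M line_measure) (\<lambda>(x, y). (y, x)))"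
    unfolding pair_energy_def by (subst distr_pair_swap) rule
  also have "\<dots> = pair_energy a S S'"
    unfolding pair_energy_def
  proof (subst nn_integral_distr, goal_cases)
    case 3
    have "W (- a, v - u) = W (a, u - v)" for u v using interaction_minus[of a "u - v"] by simp
    then show ?case by (intro nn_integral_cong) (auto split: split_indicator)
  qed measurable
  finally show ?thesis .
qed

lemma pair_energy_add:
  assumes [measurable]: "S \<in> sets borel" "A \<in> sets borel"
  shows "pair_energy a S UNIV = pair_energy a S A + pair_energy a S (- A)"
  unfolding pair_energy_def
  by (subst nn_integral_add[symmetric]) (auto intro!: nn_integral_cong split: split_indicator)

lemma pair_energy_iterated:
  assumes [measurable]: "S \<in> sets borel" "S' \<in> sets borel"
  shows "pair_energy a S S' =
    (\<integral>\<^sup>+t. indicator S t * (\<integral>\<^sup>+t'. indicator S' t' * W (a, t - t') \<partial>line_measure) \<partial>line_measure)"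
proof -
  interpret sigma_finite_measure line_measure by (rule sigma_finite_line)
  have [measurable]: "(\<lambda>t'. W (a, t - t')) \<in> borel_measurable borel" for t
  proof -
    have "(\<lambda>t'. (a, t - t')) \<in> borel \<rightarrow>\<^sub>M (borel :: (real \<times> real) measure)"
      unfolding borel_prod[symmetric] by measurable
    then show ?thesis by measurable
  qed
  have "pair_energy a S S' = (\<integral>\<^sup>+t. \<integral>\<^sup>+t'. indicator (S \<times> S') (t, t') * W (a, t - t') \<partial>line_measure \<partial>line_measure)"
    unfolding pair_energy_def by (subst nn_integral_fst[symmetric]) auto
  also have "\<dots> = (\<integral>\<^sup>+t. \<integral>\<^sup>+t'. indicator S t * (indicator S' t' * W (a, t - t')) \<partial>line_measure \<partial>line_measure)"
    by (intro nn_integral_cong) (auto split: split_indicator)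
  also have "\<dots> = (\<integral>\<^sup>+t. indicator S t * (\<integral>\<^sup>+t'. indicator S' t' * W (a, t - t') \<partial>line_measure) \<partial>line_measure)"
    by (intro nn_integral_cong nn_integral_cmult) measurable
  finally show ?thesis .
qed

lemma pair_energy_potential:
  assumes [measurable]: "S \<in> sets borel"
  shows "pair_energy a S UNIV = (\<integral>\<^sup>+t. indicator S t * ennreal (potential a t) \<partial>line_measure)"
  by (simp add: pair_energy_iterated nn_integral_interaction)

text \<open>
  The potential is continuous, hence bounded on the support of \<open>\<psi>\<close>. Finiteness allows cancellation of
  the unchanged parts of the energy.
\<close>

lemma pair_energy_finite: "pair_energy 0 UNIV UNIV < \<infinity>"
proof -
  interpret prob_space line_measure by (rule measure_line)
  obtain R where R: "\<And>t. R < \<bar>t\<bar> \<Longrightarrow> \<psi> t = 0" using \<psi>_vanishes by blast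
  have "continuous_on {- R..R} (potential 0)"
    using potential_isCont by (intro continuous_at_imp_continuous_on) auto
  then have "bounded (potential 0 ` {- R..R})"
    by (intro compact_imp_bounded compact_continuous_image) auto
  then obtain C where C: "\<And>t. t \<in> {- R..R} \<Longrightarrow> \<bar>potential 0 t\<bar> \<le> C"
    unfolding bounded_iff real_norm_def by blast
  have "pair_energy 0 UNIV UNIV = (\<integral>\<^sup>+t. ennreal (potential 0 t) \<partial>line_measure)"
    by (simp add: pair_energy_potential)
  also have "\<dots> \<le> (\<integral>\<^sup>+t. ennreal C \<partial>line_measure)"
  proof (intro nn_integral_mono_AE)
    have "ennreal (potential 0 t) \<le> ennreal C" if "\<psi> t > 0" for t
    proof -
      have "\<not> R < \<bar>t\<bar>" using R[of t] that by auto
      then have "t \<in> {- R..R}" by auto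
      then show ?thesis using C[of t] by (intro ennreal_leI) simp
    qed
    then show "AE t in line_measure. ennreal (potential 0 t) \<le> ennreal C"
      by (subst AE_density) auto
  qed
  also have "\<dots> = ennreal C" using emeasure_space_1 by simp
  finally show ?thesis by (simp add: order_le_less_trans)
qed

text \<open>
  Pairs on the same side of the partition keep their difference vector, because the moved part is
  translated rigidly; the two kinds of mixed pairs are exchanged by \<open>x \<mapsto> -x\<close>, under which \<open>W\<close> is
  invariant.
\<close>

lemma energy_shifted_line:
  assumes [measurable]: "A \<in> sets borel"
  shows "energy W (distr line_measure borel (shifted_line A \<epsilon>))
    = ((pair_energy 0 A A + pair_energy 0 (- A) (- A)) + 2 * pair_energy \<epsilon> A (- A)) / 2"
proof -
  let ?M = "line_measure \<Otimes>\<^sub>M line_measure"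
  let ?f = "\<lambda>a S S' z. indicator (S \<times> S') z * W (a, fst z - snd z)"
  have "(\<integral>\<^sup>+z. W (shifted_line A \<epsilon> (fst z) - shifted_line A \<epsilon> (snd z)) \<partial>?M)
      = (\<integral>\<^sup>+z. (?f 0 A A z + ?f 0 (- A) (- A) z) + (?f \<epsilon> A (- A) z + ?f (- \<epsilon>) (- A) A z) \<partial>?M)"
    by (intro nn_integral_cong) (auto simp: shifted_line_def split: split_indicator)
  also have "\<dots> = (pair_energy 0 A A + pair_energy 0 (- A) (- A)) + (pair_energy \<epsilon> A (- A) + pair_energy (- \<epsilon>) (- A) A)"
    unfolding pair_energy_def by (simp add: nn_integral_add)
  also have "pair_energy (- \<epsilon>) (- A) A = pair_energy \<epsilon> A (- A)"
    by (rule pair_energy_swap) auto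
  finally show ?thesis by (simp add: energy_distr mult_2)
qed

text \<open>
  Only the mixed energy \<open>Y\<close> differs from its original value \<open>X\<close>. It is at most the energy of the
  moved part in the whole potential \<open>potential \<epsilon>\<close>, while \<open>X\<close> is that energy in \<open>potential 0\<close> minus the
  self-energy \<open>Z\<close>. One \<open>\<delta>\<close> of the assumed gain pays for \<open>Z\<close>, the other makes the inequality strict.
\<close>

lemma energy_decreases:
  assumes A [measurable]: "A \<in> sets borel" and \<delta>: "\<delta> > 0"
    and mass: "emeasure line_measure A > 0"
    and gain: "\<And>t. t \<in> A \<Longrightarrow> potential \<epsilon> t + 2 * \<delta> \<le> potential 0 t"
    and self: "\<And>t. t \<in> A \<Longrightarrow> (\<integral>\<^sup>+t'. indicator A t' * W (0, t - t') \<partial>line_measure) \<le> ennreal \<delta>"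
  shows "energy W (distr line_measure borel (shifted_line A \<epsilon>)) < energy W (vertical_measure \<psi>)"
proof -
  interpret prob_space line_measure by (rule measure_line)
  define P where "P = pair_energy 0 A A + pair_energy 0 (- A) (- A)"
  define X where "X = pair_energy 0 A (- A)"
  define Y where "Y = pair_energy \<epsilon> A (- A)"
  define Z where "Z = pair_energy 0 A A"
  have "Y + Z + ennreal \<delta> * emeasure line_measure A \<le> pair_energy \<epsilon> A UNIV + Z + ennreal \<delta> * emeasure line_measure A"
    unfolding Y_def by (intro add_mono) (simp_all add: pair_energy_add[of A A])
  also have "\<dots> \<le> (\<integral>\<^sup>+t. indicator A t * ennreal (potential \<epsilon> t) \<partial>line_measure)
      + (\<integral>\<^sup>+t. indicator A t * ennreal \<delta> \<partial>line_measure) + (\<integral>\<^sup>+t. indicator A t * ennreal \<delta> \<partial>line_measure)"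
  proof (intro add_mono)
    show "pair_energy \<epsilon> A UNIV \<le> (\<integral>\<^sup>+t. indicator A t * ennreal (potential \<epsilon> t) \<partial>line_measure)"
      by (simp add: pair_energy_potential)
    show "Z \<le> (\<integral>\<^sup>+t. indicator A t * ennreal \<delta> \<partial>line_measure)"
      unfolding Z_def pair_energy_iterated[OF A A]
      using self by (intro nn_integral_mono) (auto split: split_indicator)
    show "ennreal \<delta> * emeasure line_measure A \<le> (\<integral>\<^sup>+t. indicator A t * ennreal \<delta> \<partial>line_measure)"
      by (subst nn_integral_multc) (auto simp: mult.commute)
  qed
  also have "\<dots> = (\<integral>\<^sup>+t. indicator A t * ennreal (potential \<epsilon> t) + indicator A t * ennreal \<delta> + indicator A t * ennreal \<delta> \<partial>line_measure)"
  proof -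
    have [measurable]: "potential \<epsilon> \<in> borel_measurable borel"
      using potential_isCont by (intro borel_measurable_continuous_onI) (simp add: continuous_at_imp_continuous_on)
    show ?thesis by (simp add: nn_integral_add)
  qed
  also have "\<dots> \<le> (\<integral>\<^sup>+t. indicator A t * ennreal (potential 0 t) \<partial>line_measure)"
  proof (intro nn_integral_mono)
    fix t
    have "ennreal (potential \<epsilon> t) + ennreal \<delta> + ennreal \<delta> \<le> ennreal (potential 0 t)" if "t \<in> A"
      using gain[OF that] \<delta> potential_nonneg[of \<epsilon> t] by (simp flip: ennreal_plus)
    then show "indicator A t * ennreal (potential \<epsilon> t) + indicator A t * ennreal \<delta> + indicator A t * ennreal \<delta>
        \<le> indicator A t * ennreal (potential 0 t)"
      by (auto split: split_indicator)
  qed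
  also have "\<dots> = Z + X" unfolding Z_def X_def by (simp add: pair_energy_potential flip: pair_energy_add)
  finally have ineq: "Y + Z + ennreal \<delta> * emeasure line_measure A \<le> Z + X" .
  have e0: "energy W (vertical_measure \<psi>) = (P + 2 * X) / 2"
  proof -
    have "energy W (vertical_measure \<psi>) = energy W (distr line_measure borel (shifted_line A 0))"
      by (simp add: vertical_measure_def shifted_line_def[abs_def])
    then show ?thesis using energy_shifted_line[OF A, of 0] by (simp add: P_def X_def)
  qed
  have "(P + 2 * X) / 2 = energy W (distr line_measure borel (shifted_line UNIV 0))"
    unfolding e0[symmetric] by (simp add: vertical_measure_def shifted_line_def[abs_def])
  also have "\<dots> = pair_energy 0 UNIV UNIV / 2"
    using energy_shifted_line[of UNIV 0] by (simp add: pair_energy_def)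
  also have "\<dots> < \<infinity>"
    using pair_energy_finite by (cases "pair_energy 0 UNIV UNIV") (auto simp: ennreal_divide_numeral)
  finally have "(P + 2 * X) / 2 \<noteq> top" by simp
  then have "P + 2 * X \<noteq> top" by (auto simp: ennreal_divide_eq_top_iff)
  then have "P \<noteq> top" "2 * X \<noteq> top" by auto
  then have "P \<noteq> top" "X \<noteq> top" by (auto simp: ennreal_mult_eq_top_iff)
  then have fin: "P < \<infinity>" "X < \<infinity>"
    unfolding infinity_ennreal_def top.not_eq_extremum by blast+
  have "Z \<le> P" by (simp add: P_def Z_def)
  then have Zf: "Z < \<infinity>" using fin(1) by (rule order_le_less_trans)
  have Yf: "Y < \<infinity>"
  proof -
    have "Y \<le> Y + (Z + ennreal \<delta> * emeasure line_measure A)" by simp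
    also have "\<dots> \<le> Z + X" using ineq by (simp add: add.assoc)
    also have "\<dots> < \<infinity>" using Zf fin by simp
    finally show ?thesis .
  qed
  have af: "emeasure line_measure A < \<infinity>"
    using emeasure_finite[of A] unfolding infinity_ennreal_def top.not_eq_extremum .
  obtain p where p: "P = ennreal p" "p \<ge> 0" using fin(1) by (cases P) auto
  obtain x where x: "X = ennreal x" "x \<ge> 0" using fin(2) by (cases X) auto
  obtain y where y: "Y = ennreal y" "y \<ge> 0" using Yf by (cases Y) auto
  obtain z where z: "Z = ennreal z" "z \<ge> 0" using Zf by (cases Z) auto
  obtain a where a: "emeasure line_measure A = ennreal a" "a \<ge> 0"
    using af by (cases "emeasure line_measure A") auto
  have "a > 0" using mass a by simp
  have "Y + Z + ennreal \<delta> * emeasure line_measure A = ennreal (y + z + \<delta> * a)" "Z + X = ennreal (z + x)"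
    using x y z a \<delta> by (simp_all add: ennreal_plus ennreal_mult)
  with ineq have "ennreal (y + z + \<delta> * a) \<le> ennreal (z + x)" by (simp only:)
  then have "y + z + \<delta> * a \<le> z + x" using x z by (subst (asm) ennreal_le_iff) auto
  moreover have "\<delta> * a > 0" using \<open>a > 0\<close> \<delta> by simp
  ultimately have "y < x" by linarith
  have "P + 2 * Y = ennreal (p + 2 * y)" "P + 2 * X = ennreal (p + 2 * x)"
    using p x y by (simp_all add: ennreal_plus ennreal_mult)
  then have "(P + 2 * Y) / 2 = ennreal ((p + 2 * y) / 2)" "(P + 2 * X) / 2 = ennreal ((p + 2 * x) / 2)"
    using p x y by (simp_all only: ennreal_divide_numeral)
  then have "(P + 2 * Y) / 2 < (P + 2 * X) / 2"
    using \<open>y < x\<close> p x y by (simp add: ennreal_less_iff)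
  then show ?thesis unfolding e0 energy_shifted_line[OF A] P_def Y_def .
qed

end

section \<open>The line is not a local minimizer\<close>

context vertical_line
begin

text \<open>
  The potential of a short segment at its own points is at most a multiple of the integral of the locally
  integrable kernel over an interval of twice its length.
\<close>

lemma self_interaction_small:
  assumes \<delta>: "\<delta> > 0"
  obtains \<eta>0 where "\<eta>0 > 0" "\<And>\<eta> t. \<eta> \<le> \<eta>0 \<Longrightarrow> t \<in> {- \<eta><..<\<eta>} \<Longrightarrow>
     (\<integral>\<^sup>+t'. indicator {- \<eta><..<\<eta>} t' * W (0, t - t') \<partial>line_measure) \<le> ennreal \<delta>"
proof -
  obtain B where B: "B > 0" "\<And>t. \<bar>\<psi> t\<bar> \<le> B" using \<psi>_bounded by blast
  define k where "k = (\<lambda>r v. indicator {- r..r} v * kernel 0 v)"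
  have ki: "integrable lborel (k r)" for r
    unfolding k_def by (rule kernel_locally_integrable)
  \<comment> \<open>The integrals over shrinking intervals tend to the integral over \<open>{0}\<close>.\<close>
  have "(\<lambda>n. LINT v|lborel. k (1 / real (Suc n)) v) \<longlonglongrightarrow> (LINT v::real|lborel. (0::real))"
  proof (rule integral_dominated_convergence[where w = "k 1"])
    show "AE v in lborel. (\<lambda>n. k (1 / real (Suc n)) v) \<longlonglongrightarrow> 0"
      using AE_lborel_singleton[of "0::real"]
    proof eventually_elim
      case (elim v)
      have "(\<lambda>n. 1 / real (Suc n)) \<longlonglongrightarrow> 0" using LIMSEQ_inverse_real_of_nat by (simp add: inverse_eq_divide)
      then have "\<forall>\<^sub>F n in sequentially. 1 / real (Suc n) < \<bar>v\<bar>"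
        using elim by (intro order_tendstoD) auto
      then have "\<forall>\<^sub>F n in sequentially. k (1 / real (Suc n)) v = 0"
        by eventually_elim (auto simp: k_def split: split_indicator)
      then show ?case by (rule tendsto_eventually)
    qed
    show "AE v in lborel. norm (k (1 / real (Suc n)) v) \<le> k 1 v" for n
    proof (intro AE_I2)
      fix v :: real
      have "norm (k q v) \<le> k 1 v" if "q \<le> 1" for q
        using that kernel_nonneg[of 0 v] by (auto simp: k_def split: split_indicator)
      then show "norm (k (1 / real (Suc n)) v) \<le> k 1 v" by simp
    qed
  qed (use ki in \<open>auto simp: borel_measurable_integrable\<close>)
  then have "\<forall>\<^sub>F n in sequentially. (LINT v|lborel. k (1 / real (Suc n)) v) < \<delta> / B"
    using \<delta> B by (intro order_tendstoD) auto
  then obtain n where n: "(LINT v|lborel. k (1 / real (Suc n)) v) < \<delta> / B"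
    by (auto simp: eventually_sequentially)
  define r where "r = 1 / real (Suc n)"
  have r: "r > 0" "B * (LINT v|lborel. k r v) \<le> \<delta>"
    using n B by (auto simp: r_def field_simps)
  have "(\<integral>\<^sup>+t'. indicator {- \<eta><..<\<eta>} t' * W (0, t - t') \<partial>line_measure) \<le> ennreal \<delta>"
    if "\<eta> \<le> r / 2" "t \<in> {- \<eta><..<\<eta>}" for \<eta> t
  proof -
    have [measurable]: "(\<lambda>t'. W (0, t - t')) \<in> borel_measurable borel"
    proof -
      have "(\<lambda>t'. (0, t - t')) \<in> borel \<rightarrow>\<^sub>M (borel :: (real \<times> real) measure)"
        unfolding borel_prod[symmetric] by measurable
      then show ?thesis by measurable
    qed
    have "(\<integral>\<^sup>+t'. indicator {- \<eta><..<\<eta>} t' * W (0, t - t') \<partial>line_measure)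
        = (\<integral>\<^sup>+t'. ennreal (\<psi> t') * (indicator {- \<eta><..<\<eta>} t' * W (0, t - t')) \<partial>lborel)"
      by (subst nn_integral_density) auto
    also have "\<dots> \<le> (\<integral>\<^sup>+t'. ennreal (B * k r (t - t')) \<partial>lborel)"
    proof (rule nn_integral_mono_AE)
      show "AE t' in lborel. ennreal (\<psi> t') * (indicator {- \<eta><..<\<eta>} t' * W (0, t - t')) \<le> ennreal (B * k r (t - t'))"
        using AE_lborel_singleton[of t]
      proof eventually_elim
        case (elim t')
        have w: "W (0, t - t') = ennreal (kernel 0 (t - t'))"
          using elim by (simp add: interaction_line_kernel[of \<Omega> s, OF \<Omega>_periodic])
        show ?case
        proof (cases "t' \<in> {- \<eta><..<\<eta>}")
          case True
          then have "t - t' \<in> {- r..r}" using that by auto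
          then have "k r (t - t') = kernel 0 (t - t')" by (simp add: k_def)
          moreover have "\<psi> t' * kernel 0 (t - t') \<le> B * kernel 0 (t - t')"
            using B(2)[of t'] kernel_nonneg by (intro mult_right_mono) auto
          ultimately show ?thesis
            using True unfolding w by (simp add: \<psi>_nonneg kernel_nonneg ennreal_leI flip: ennreal_mult)
        qed simp
      qed
    qed
    also have "\<dots> = ennreal (LINT t'|lborel. B * k r (t - t'))"
    proof (rule nn_integral_eq_integral)
      show "integrable lborel (\<lambda>t'. B * k r (t - t'))"
        using lborel_integrable_real_affine[OF ki, of "- 1" r t] by simp
      show "AE t' in lborel. 0 \<le> B * k r (t - t')"
        using B kernel_nonneg by (auto simp: k_def)
    qed
    also have "(LINT t'|lborel. B * k r (t - t')) = B * (LINT v|lborel. k r v)"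
      using lborel_integral_real_affine[of "- 1" "k r" t] by simp
    finally show ?thesis using r(2) by (meson ennreal_leI order_trans)
  qed
  then show thesis using that[of "r / 2"] r(1) by simp
qed

lemma line_mass_pos:
  assumes \<psi>0: "\<psi> 0 > 0" and \<eta>: "\<eta> > 0"
  shows "emeasure line_measure {- \<eta><..<\<eta>} > 0"
proof -
  have "isCont \<psi> 0" using \<psi>_cont by (simp add: continuous_on_eq_continuous_at)
  then have "(\<psi> \<longlongrightarrow> \<psi> 0) (nhds 0)" by (simp add: isCont_def tendsto_at_iff_tendsto_nhds)
  then have "\<forall>\<^sub>F t in nhds 0. \<psi> 0 / 2 < \<psi> t" using \<psi>0 by (intro order_tendstoD) auto
  then obtain d where d: "d > 0" "\<And>t. \<bar>t\<bar> < d \<Longrightarrow> \<psi> 0 / 2 < \<psi> t"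
    unfolding eventually_nhds_metric dist_real_def by auto
  define c where "c = min d \<eta>"
  have c: "c > 0" "c \<le> d" "c \<le> \<eta>" using d \<eta> by (auto simp: c_def)
  have "0 < ennreal (\<psi> 0 / 2) * ennreal (2 * c)" using \<psi>0 c by (simp flip: ennreal_mult)
  also have "ennreal (\<psi> 0 / 2) * ennreal (2 * c) = (\<integral>\<^sup>+t. ennreal (\<psi> 0 / 2) * indicator {- c<..<c} t \<partial>lborel)"
    using c by (subst nn_integral_cmult_indicator) auto
  also have "\<dots> \<le> (\<integral>\<^sup>+t. ennreal (\<psi> t) * indicator {- \<eta><..<\<eta>} t \<partial>lborel)"
  proof (intro nn_integral_mono)
    fix t :: real
    have "\<psi> 0 / 2 \<le> \<psi> t" if "t \<in> {- c<..<c}"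
    proof -
      have "\<bar>t\<bar> < d" using that c by auto
      then show ?thesis using d(2) by (simp add: less_imp_le)
    qed
    then show "ennreal (\<psi> 0 / 2) * indicator {- c<..<c} t \<le> ennreal (\<psi> t) * indicator {- \<eta><..<\<eta>} t"
      using c by (auto split: split_indicator intro!: ennreal_leI)
  qed
  also have "\<dots> = emeasure line_measure {- \<eta><..<\<eta>}" by (simp add: emeasure_density)
  finally show ?thesis .
qed

text \<open>
  The coupling that transports each point to its image moves no point farther than \<open>\<epsilon>\<close>.
\<close>

lemma wasserstein_shifted_line:
  assumes [measurable]: "A \<in> sets borel" and \<epsilon>: "\<epsilon> \<ge> 0"
  shows "wasserstein_inf (vertical_measure \<psi>) (distr line_measure borel (shifted_line A \<epsilon>)) \<le> ennreal \<epsilon>"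
proof -
  interpret prob_space line_measure by (rule measure_line)
  define G where "G = (\<lambda>t. ((0::real, t), shifted_line A \<epsilon> t))"
  have s0 [measurable]: "(\<lambda>t::real. (0::real, t)) \<in> borel_measurable borel"
    by (intro borel_measurable_continuous_onI continuous_intros)
  have G [measurable]: "G \<in> borel \<rightarrow>\<^sub>M (borel \<Otimes>\<^sub>M borel)" unfolding G_def by measurable
  define \<gamma> where "\<gamma> = distr line_measure (borel \<Otimes>\<^sub>M borel) G"
  have "\<gamma> \<in> couplings (vertical_measure \<psi>) (distr line_measure borel (shifted_line A \<epsilon>))"
    unfolding couplings_def
  proof (intro CollectI conjI)
    show "prob_space \<gamma>" unfolding \<gamma>_def by (rule prob_space_distr) simp
    show "sets \<gamma> = sets (borel \<Otimes>\<^sub>M borel)" by (simp add: \<gamma>_def)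
    show "distr \<gamma> borel fst = vertical_measure \<psi>"
      unfolding \<gamma>_def vertical_measure_def by (subst distr_distr) (auto simp: G_def comp_def)
    show "distr \<gamma> borel snd = distr line_measure borel (shifted_line A \<epsilon>)"
      unfolding \<gamma>_def by (subst distr_distr) (auto simp: G_def comp_def)
  qed
  then have "wasserstein_inf (vertical_measure \<psi>) (distr line_measure borel (shifted_line A \<epsilon>))
      \<le> esssup \<gamma> (\<lambda>(x, y). ennreal (dist x y))"
    unfolding wasserstein_inf_def by (rule INF_lower)
  also have "\<dots> \<le> ennreal \<epsilon>"
  proof (rule esssup_I)
    have [measurable]: "(\<lambda>(x, y). ennreal (dist x y)) \<in> borel_measurable (borel \<Otimes>\<^sub>M (borel :: (real \<times> real) measure))"
      by measurable
    then show "(\<lambda>(x, y). ennreal (dist x y)) \<in> borel_measurable \<gamma>" by (simp add: \<gamma>_def)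
    have "dist (0, t) (shifted_line A \<epsilon> t) \<le> \<epsilon>" for t
      using \<epsilon> by (simp add: shifted_line_def dist_prod_def)
    then show "AE z in \<gamma>. (case z of (x, y) \<Rightarrow> ennreal (dist x y)) \<le> ennreal \<epsilon>"
      unfolding \<gamma>_def by (subst AE_distr_iff) (auto simp: G_def intro!: ennreal_leI)
  qed
  finally show ?thesis .
qed

text \<open>
  The strict inequality at the single height \<open>0\<close> persists for nearby heights by continuity of the two
  potentials; the segment is chosen after \<open>\<epsilon>\<close>, so its self-interaction may be made small compared with
  the gain. The constant \<open>1/4\<close> in \<open>\<delta>\<close> leaves room for one \<open>\<delta>\<close> of loss in each potential and a gain of
  \<open>2 * \<delta>\<close>.
\<close>

lemma not_local_minimizer_if_potential_lower:
  assumes lower: "\<And>e. e > 0 \<Longrightarrow> \<exists>\<epsilon>. 0 < \<epsilon> \<and> \<epsilon> < e \<and> potential \<epsilon> 0 < potential 0 0"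
    and \<psi>0: "\<psi> 0 > 0"
  shows "\<not> winf_local_minimizer W (vertical_measure \<psi>)"
proof
  assume "winf_local_minimizer W (vertical_measure \<psi>)"
  then obtain e where e: "e > 0" and min: "\<And>\<rho>'. prob_on_plane \<rho>' \<Longrightarrow>
      wasserstein_inf (vertical_measure \<psi>) \<rho>' < ennreal e \<Longrightarrow> energy W (vertical_measure \<psi>) \<le> energy W \<rho>'"
    unfolding winf_local_minimizer_def by blast
  obtain \<epsilon> where \<epsilon>: "0 < \<epsilon>" "\<epsilon> < e" "potential \<epsilon> 0 < potential 0 0" using lower[OF e] by blast
  define \<delta> where "\<delta> = (potential 0 0 - potential \<epsilon> 0) / 4"
  have \<delta>: "\<delta> > 0" using \<epsilon> by (simp add: \<delta>_def)
  have lim: "(potential a \<longlongrightarrow> potential a 0) (nhds 0)" for a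
    using potential_isCont[of 0 a] by (simp add: isCont_def tendsto_at_iff_tendsto_nhds)
  have "\<forall>\<^sub>F t in nhds 0. potential \<epsilon> t < potential \<epsilon> 0 + \<delta>" "\<forall>\<^sub>F t in nhds 0. potential 0 0 - \<delta> < potential 0 t"
    using \<delta> by (intro order_tendstoD(2)[OF lim] order_tendstoD(1)[OF lim]; simp)+
  then have "\<forall>\<^sub>F t in nhds 0. potential \<epsilon> t + 2 * \<delta> \<le> potential 0 t"
    by eventually_elim (simp add: \<delta>_def field_simps)
  then obtain \<eta>1 where \<eta>1: "\<eta>1 > 0" "\<And>t. \<bar>t\<bar> < \<eta>1 \<Longrightarrow> potential \<epsilon> t + 2 * \<delta> \<le> potential 0 t"
    unfolding eventually_nhds_metric dist_real_def by auto
  obtain \<eta>0 where \<eta>0: "\<eta>0 > 0" "\<And>\<eta> t. \<eta> \<le> \<eta>0 \<Longrightarrow> t \<in> {- \<eta><..<\<eta>} \<Longrightarrow>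
     (\<integral>\<^sup>+t'. indicator {- \<eta><..<\<eta>} t' * W (0, t - t') \<partial>line_measure) \<le> ennreal \<delta>"
    using self_interaction_small[OF \<delta>] by blast
  define \<eta> where "\<eta> = min \<eta>0 \<eta>1"
  define A where "A = {- \<eta><..<\<eta>}"
  have A: "A \<in> sets borel" by (simp add: A_def)
  have less: "energy W (distr line_measure borel (shifted_line A \<epsilon>)) < energy W (vertical_measure \<psi>)"
  proof (rule energy_decreases[OF A \<delta>])
    show "emeasure line_measure A > 0"
      unfolding A_def using \<eta>0 \<eta>1 by (intro line_mass_pos[OF \<psi>0]) (simp add: \<eta>_def)
    show "potential \<epsilon> t + 2 * \<delta> \<le> potential 0 t" if "t \<in> A" for t
      using that by (intro \<eta>1) (auto simp: A_def \<eta>_def)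
    show "(\<integral>\<^sup>+t'. indicator A t' * W (0, t - t') \<partial>line_measure) \<le> ennreal \<delta>" if "t \<in> A" for t
      using that unfolding A_def by (intro \<eta>0) (auto simp: \<eta>_def)
  qed
  have "prob_on_plane (distr line_measure borel (shifted_line A \<epsilon>))"
    unfolding prob_on_plane_def using A by (auto intro!: prob_space.prob_space_distr measure_line)
  moreover have "wasserstein_inf (vertical_measure \<psi>) (distr line_measure borel (shifted_line A \<epsilon>)) < ennreal e"
    using wasserstein_shifted_line[OF A, of \<epsilon>] \<epsilon> by (auto intro: order_le_less_trans simp: ennreal_less_iff)
  ultimately show False using min less by (meson not_le)
qed

text \<open>
  The main term is a negative multiple of \<open>\<epsilon> powr (1 - s)\<close> and dominates the remainder \<open>O(\<epsilon>)\<close>.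
\<close>

lemma potential_lower_nearby:
  assumes rem: "remainder \<in> O[at_right 0](\<lambda>\<epsilon>. \<epsilon>)"
    and \<Omega>t: "Omega_tilde s \<Omega> 0 > 0" and \<psi>0: "\<psi> 0 > 0" and e: "e > 0"
  shows "\<exists>\<epsilon>. 0 < \<epsilon> \<and> \<epsilon> < e \<and> potential \<epsilon> 0 < potential 0 0"
proof -
  define c where "c = 1 / (2 * tau (2 - s)) * Omega_tilde s \<Omega> 0 * \<psi> 0"
  have c: "c < 0" unfolding c_def using tau_neg[OF s] \<Omega>t \<psi>0 by (simp add: divide_pos_neg)
  obtain K where K: "K > 0" "\<forall>\<^sub>F \<epsilon> in at_right 0. norm (remainder \<epsilon>) \<le> K * norm \<epsilon>"
    using landau_o.bigE[OF rem] by blast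
  have "((\<lambda>\<epsilon>::real. \<epsilon> powr s) \<longlongrightarrow> 0) (at_right 0)" using s by real_asymp
  then have "\<forall>\<^sub>F \<epsilon> in at_right 0. \<epsilon> powr s < - c / K"
    using c K(1) by (intro order_tendstoD) (auto simp: divide_neg_pos)
  with K(2) have "\<forall>\<^sub>F \<epsilon> in at_right 0. 0 < \<epsilon> \<and> \<epsilon> < e \<and> potential \<epsilon> 0 < potential 0 0"
    using eventually_at_right_real[OF e]
  proof eventually_elim
    case (elim \<epsilon>)
    then have \<epsilon>: "0 < \<epsilon>" "\<epsilon> < e" by auto
    have "potential \<epsilon> 0 - potential 0 0 = remainder \<epsilon> + c * \<epsilon> powr (1 - s)"
      by (simp add: remainder_def c_def)
    also have "\<dots> \<le> K * \<epsilon> + c * \<epsilon> powr (1 - s)" using elim(1) \<epsilon> by simp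
    also have "K * \<epsilon> = K * \<epsilon> powr s * \<epsilon> powr (1 - s)" using \<epsilon> by (simp add: powr_diff)
    also have "K * \<epsilon> powr s * \<epsilon> powr (1 - s) + c * \<epsilon> powr (1 - s) = (K * \<epsilon> powr s + c) * \<epsilon> powr (1 - s)"
      by (simp add: algebra_simps)
    also have "\<dots> < 0"
    proof (rule mult_neg_pos)
      show "K * \<epsilon> powr s + c < 0" using elim(2) unfolding pos_less_divide_eq[OF K(1)]
        by (simp add: mult.commute)
      show "\<epsilon> powr (1 - s) > 0" using \<epsilon> by simp
    qed
    finally show ?case using \<epsilon> by simp
  qed
  then show ?thesis using eventually_happens'[OF trivial_limit_at_right_real] by blast
qed

end

theorem proposition6p1:
  fixes s :: real and \<Omega> \<psi> :: "real \<Rightarrow> real"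
  defines "W \<equiv> interaction s \<Omega>"
    and "\<rho> \<equiv> vertical_measure \<psi>"
  defines "err \<equiv> (\<lambda>\<epsilon>::real. enn2real (convol W \<rho> (\<epsilon>, 0)) - enn2real (convol W \<rho> (0, 0))
                    - 1 / (2 * tau (2 - s)) * Omega_tilde s \<Omega> 0 * \<psi> 0 * \<epsilon> powr (1 - s))"
  assumes s: "0 < s" "s < 1"
    and \<Omega>_smooth: "smooth \<Omega>"
    and \<Omega>_pos: "\<And>\<theta>. \<Omega> \<theta> > 0"
    and \<Omega>_periodic: "\<And>\<theta>. \<Omega> (\<theta> + pi) = \<Omega> \<theta>"
    and \<psi>_nonneg: "\<And>t. \<psi> t \<ge> 0"
    and \<psi>_cont: "continuous_on UNIV \<psi>"
    and \<psi>_supp: "compact (closure {t. \<psi> t \<noteq> 0})"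
    and \<psi>_mass: "(\<integral>t. \<psi> t \<partial>lborel) = 1"
    and \<psi>_C1: "\<exists>d>0. \<psi> C1_differentiable_on {-d<..<d}"
  shows "tau (2 - s) < 0 \<and>
     (\<forall>\<epsilon>\<ge>0. convol W \<rho> (\<epsilon>, 0) < \<infinity>) \<and>
     err \<in> O[at_right 0](\<lambda>\<epsilon>. \<epsilon>) \<and>
     ((\<forall>\<^sub>F \<theta> in nhds (pi / 2). \<Omega> (pi / 2) \<le> \<Omega> \<theta>) \<longrightarrow>
        err \<in> O[at_right 0](\<lambda>\<epsilon>. \<epsilon> powr (2 - s))) \<and>
     (Omega_tilde s \<Omega> 0 > 0 \<and> \<psi> 0 > 0 \<longrightarrow> \<not> winf_local_minimizer W \<rho>)"
proof -
  have d1: "(\<Omega> has_real_derivative deriv \<Omega> \<theta>) (at \<theta>)" for \<theta>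
    using \<Omega>_smooth[unfolded smooth_def, rule_format, of 0 \<theta>]
    by (simp add: DERIV_deriv_iff_real_differentiable)
  have d2: "(deriv \<Omega> has_real_derivative deriv (deriv \<Omega>) \<theta>) (at \<theta>)" for \<theta>
    using \<Omega>_smooth[unfolded smooth_def, rule_format, of 1 \<theta>]
    by (simp add: DERIV_deriv_iff_real_differentiable)
  have "continuous_on UNIV \<Omega>"
    using d1 by (intro continuous_at_imp_continuous_on) (auto intro: DERIV_isCont)
  then interpret vertical_line s \<Omega> \<psi>
    using s \<Omega>_pos \<Omega>_periodic \<psi>_nonneg \<psi>_cont \<psi>_supp \<psi>_mass by unfold_locales auto
  obtain D' where D': "(\<psi> has_real_derivative D') (at 0)"
  proof -
    from \<psi>_C1 obtain d where d: "d > 0" "\<psi> C1_differentiable_on {-d<..<d}" by blast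
    then obtain D where "\<And>x. x \<in> {-d<..<d} \<Longrightarrow> (\<psi> has_vector_derivative D x) (at x)"
      unfolding C1_differentiable_on_def by blast
    from this[of 0] d(1) show thesis
      using that by (simp add: has_real_derivative_iff_has_vector_derivative)
  qed
  have err: "err = remainder"
    unfolding err_def remainder_def W_def \<rho>_def
    by (simp add: convol_potential potential_nonneg fun_eq_iff)
  have lin: "remainder \<in> O[at_right 0](\<lambda>\<epsilon>. \<epsilon>)" by (rule remainder_linear[OF d1 D'])
  have quad: "remainder \<in> O[at_right 0](\<lambda>\<epsilon>. \<epsilon> powr (2 - s))"
    if "\<forall>\<^sub>F \<theta> in nhds (pi / 2). \<Omega> (pi / 2) \<le> \<Omega> \<theta>"
  proof -
    from that obtain d where d: "d > 0" "\<And>\<theta>. \<bar>\<theta> - pi / 2\<bar> < d \<Longrightarrow> \<Omega> (pi / 2) \<le> \<Omega> \<theta>"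
      unfolding eventually_nhds_metric dist_real_def by blast
    have "deriv \<Omega> (pi / 2) = 0"
      using DERIV_local_min[OF d1 d(1)] d(2) by (simp add: abs_minus_commute)
    then show ?thesis by (rule remainder_critical[OF d1 d2 _ D'])
  qed
  have nomin: "\<not> winf_local_minimizer W \<rho>" if "Omega_tilde s \<Omega> 0 > 0" "\<psi> 0 > 0"
    unfolding W_def \<rho>_def
    by (rule not_local_minimizer_if_potential_lower[OF potential_lower_nearby[OF lin that] that(2)])
  show ?thesis
    unfolding err using tau_neg[OF s] lin quad nomin
    by (auto simp: W_def \<rho>_def convol_potential)
qed

end
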